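(* Let $G$ be a finite group. If $d^*(G)>\frac{2}{3}=d^*(S_3)=d'(S_3)$, then $G$ is a nilpotent group. Moreover, if in addition $2\nmid |G|$, then $G$ is the direct product of some modular $p$-groups (for possibly different primes $p$). The equalities $d^*(S_3)=d'(S_3)=\frac{2}{3}$ are part of the assertion.
   Context: All groups are finite. For a finite group $G$, $L(G)$ denotes the set (lattice) of all subgroups of $G$, $k'(G)$ the number of conjugacy classes of subgroups of $G$, and $d'(G)=\frac{k'(G)}{|L(G)|}$. A section of $G$ is a quotient $H/K$ with $K\trianglelefteq H\leq G$, and $d^*(G)=\min\{d'(S)\mid S \text{ is a section of } G\}$. A modular $p$-group is a finite $p$-group whose subgroup lattice is modular. $S_3$ is the symmetric group on three letters. *)

theory Defs
  imports "HOL-Algebra.Algebra"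
begin

definition subgroup_lattice :: "('a, 'b) monoid_scheme \<Rightarrow> 'a set gorder" where
  "subgroup_lattice G = \<lparr>carrier = {H. subgroup H G}, eq = (=), le = (\<subseteq>)\<rparr>"

(* The orbits of G acting by conjugation on the set of its subgroups; the action is
   the one of the library theorem group.action_by_conjugation_on_subgroups_set. *)
definition subgroup_conj_classes :: "('a, 'b) monoid_scheme \<Rightarrow> 'a set set set" where
  "subgroup_conj_classes G =
     orbits G {H. subgroup H G}
       (\<lambda>g. \<lambda>H \<in> {H. subgroup H G}. g <#\<^bsub>G\<^esub> H #>\<^bsub>G\<^esub> (inv\<^bsub>G\<^esub> g))"

definition d_prime :: "('a, 'b) monoid_scheme \<Rightarrow> real" where
  "d_prime G = real (card (subgroup_conj_classes G)) / real (card (carrier (subgroup_lattice G)))"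

definition group_sections :: "('a, 'b) monoid_scheme \<Rightarrow> 'a set monoid set" where
  "group_sections G =
     {(G\<lparr>carrier := H\<rparr>) Mod K | H K. subgroup H G \<and> K \<lhd> (G\<lparr>carrier := H\<rparr>)}"

(* Min is only meaningful on finite nonempty sets; group.finite_group_sections and
   group.group_sections_nonempty below show that this is the case for finite groups. *)
definition d_star :: "('a, 'b) monoid_scheme \<Rightarrow> real" where
  "d_star G = Min (d_prime ` group_sections G)"

lemma (in group) finite_group_sections:
  assumes "finite (carrier G)"
  shows "finite (group_sections G)"
proof -
  have "group_sections G \<subseteq>
      (\<lambda>(H, K). (G\<lparr>carrier := H\<rparr>) Mod K) ` (Pow (carrier G) \<times> Pow (carrier G))"
  proof
    fix S assume "S \<in> group_sections G"
    then obtain H K where S: "S = (G\<lparr>carrier := H\<rparr>) Mod K"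
      and H: "subgroup H G" and K: "K \<lhd> (G\<lparr>carrier := H\<rparr>)"
      unfolding group_sections_def by blast
    have "H \<subseteq> carrier G" using H by (rule subgroup.subset)
    moreover have "K \<subseteq> H"
      using subgroup.subset[OF normal_imp_subgroup[OF K]] by simp
    ultimately show "S \<in> (\<lambda>(H, K). (G\<lparr>carrier := H\<rparr>) Mod K) ` (Pow (carrier G) \<times> Pow (carrier G))"
      unfolding S by (intro image_eqI[where x = "(H, K)"]) auto
  qed
  then show ?thesis
    using assms by (meson finite_Pow_iff finite_SigmaI finite_imageI finite_subset)
qed

lemma (in group) group_sections_nonempty: "group_sections G \<noteq> {}"
proof -
  have "carrier G \<lhd> G" by (rule normal_invI) (auto simp: subgroup_self)
  then have "(G\<lparr>carrier := carrier G\<rparr>) Mod carrier G \<in> group_sections G"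
    unfolding group_sections_def using subgroup_self by force
  then show ?thesis by blast
qed

primrec lower_central_series :: "('a, 'b) monoid_scheme \<Rightarrow> nat \<Rightarrow> 'a set" where
  "lower_central_series G 0 = carrier G"
| "lower_central_series G (Suc n) =
     generate G {x \<otimes>\<^bsub>G\<^esub> y \<otimes>\<^bsub>G\<^esub> inv\<^bsub>G\<^esub> x \<otimes>\<^bsub>G\<^esub> inv\<^bsub>G\<^esub> y | x y.
                   x \<in> lower_central_series G n \<and> y \<in> carrier G}"

definition nilpotent_group :: "('a, 'b) monoid_scheme \<Rightarrow> bool" where
  "nilpotent_group G \<longleftrightarrow> group G \<and> (\<exists>n. lower_central_series G n = {\<one>\<^bsub>G\<^esub>})"

definition modular_lattice :: "('a, 'b) gorder_scheme \<Rightarrow> bool" where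
  "modular_lattice L \<longleftrightarrow> lattice L \<and>
     (\<forall>x \<in> carrier L. \<forall>y \<in> carrier L. \<forall>z \<in> carrier L.
        x \<sqsubseteq>\<^bsub>L\<^esub> z \<longrightarrow> x \<squnion>\<^bsub>L\<^esub> (y \<sqinter>\<^bsub>L\<^esub> z) = (x \<squnion>\<^bsub>L\<^esub> y) \<sqinter>\<^bsub>L\<^esub> z)"

definition modular_p_group :: "nat \<Rightarrow> ('a, 'b) monoid_scheme \<Rightarrow> bool" where
  "modular_p_group p G \<longleftrightarrow> Factorial_Ring.prime p \<and> group G \<and> finite (carrier G) \<and>
     (\<exists>n. order G = p ^ n) \<and> modular_lattice (subgroup_lattice G)"

end

(*
  Write d' > 2/3 as: the sum of 2|c| - 3 over the conjugacy classes c of subgroups is negative.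
  Only normal subgroups contribute negative terms, -1 each, so pairwise non-conjugate subgroups
  with at least three conjugates are fewer than a third of the normal subgroups. A group with few
  normal subgroups and a subgroup with many conjugates therefore cannot occur as a section.

  Nilpotency: in a minimal group where two elements of coprime orders do not commute, all
  nontrivial normal subgroups contain their commutator. So there is a unique minimal normal
  subgroup N, the group is N<u> with u of prime order (or simple), and it has at most three
  normal subgroups, while <u> is not normalized by a subgroup of index at most two.

  Modularity: for odd p a minimal p-group with two non-permuting cyclic subgroups has order p^3
  and exponent p. Every normal subgroup other than 1, the centre and the whole group then contains
  a non-normal subgroup of order p, again contradicting the inequality. If all cyclic subgroups
  permute, joins of subgroups are products and the modular law is Dedekind's.
*)
theory Submission
  imports Defs
begin

subsection \<open>Conjugacy classes of subgroups\<close>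

text \<open>The hypothesis bounds \<open>d_prime\<close> on every section, so subgroups and
  quotients inherit it. The obstacle is typing: a quotient by cosets lives on a higher type, while
  an induction hypothesis covers only one. Sections are therefore surjections onto groups on
  \<open>nat\<close>; each property is proved there and pulled back along a surjection with trivial
  kernel. Nilpotency is not the property carried through the first induction. That elements of
  coprime orders commute restricts to subgroups verbatim, and for a quotient it says that certain
  commutators lie in the kernel. The counts are tight. In the first half at most three normal
  subgroups face one class of size at least three, against 3 * 1 < 3; \<open>S_3\<close> itself
  meets this with equality. In the second half, with m normal subgroups besides 1, the centre and
  the group, the bound gives 3 m < m + 3, so m \<le> 1, while the two generators yield m \<ge> 2.
  Oddness of p enters through p dividing p choose 2, which forces exponent p, and through odd class
  sizes, so that a non-normal subgroup has at least three conjugates.\<close>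

definition conj_class :: "('a, 'b) monoid_scheme \<Rightarrow> 'a set \<Rightarrow> 'a set set" where
  "conj_class G H = (\<lambda>g. (\<lambda>h. g \<otimes>\<^bsub>G\<^esub> h \<otimes>\<^bsub>G\<^esub> inv\<^bsub>G\<^esub> g) ` H) ` carrier G"

lemma conj_set_eq: "g <#\<^bsub>G\<^esub> H #>\<^bsub>G\<^esub> x = (\<lambda>h. g \<otimes>\<^bsub>G\<^esub> h \<otimes>\<^bsub>G\<^esub> x) ` H"
  by (auto simp: l_coset_def r_coset_def)

text \<open>The action in the definition of the classes is restricted to subgroups and written with
  cosets. On subgroups its orbits are these plain sets of images, which are easier to count and to
  transport.\<close>

lemma orbit_eq_conj_class:
  assumes "subgroup H G"
  shows "orbit G (\<lambda>g. \<lambda>H \<in> {H. subgroup H G}. g <#\<^bsub>G\<^esub> H #>\<^bsub>G\<^esub> (inv\<^bsub>G\<^esub> g)) H = conj_class G H"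
  using assms by (auto simp: orbit_def conj_class_def conj_set_eq)

lemma subgroup_conj_classes_eq:
  "subgroup_conj_classes G = conj_class G ` {H. subgroup H G}"
  unfolding subgroup_conj_classes_def orbits_def using orbit_eq_conj_class[of _ G] by (auto simp: image_def)

lemma d_prime_eq:
  "d_prime G = card (conj_class G ` {H. subgroup H G}) / card {H. subgroup H G}"
  by (simp add: d_prime_def subgroup_conj_classes_eq subgroup_lattice_def)

context group begin

lemma finite_subgroups: "finite (carrier G) \<Longrightarrow> finite {H. subgroup H G}"
  by (rule finite_subset[of _ "Pow (carrier G)"]) (auto dest: subgroup.subset)

lemma conj_class_self:
  assumes "subgroup H G"
  shows "H \<in> conj_class G H"
  using group_action.orbit_refl[OF action_by_conjugation_on_subgroups_set, of H] assms
  by (simp only: orbit_eq_conj_class mem_Collect_eq simp_thms)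

lemma card_conj_class_dvd:
  assumes "subgroup H G"
  shows "card (conj_class G H) dvd order G"
proof -
  have H: "H \<in> {H. subgroup H G}" using assms by simp
  show ?thesis
    using group_action.orbit_stabilizer_theorem[OF action_by_conjugation_on_subgroups_set H]
    unfolding orbit_eq_conj_class[OF assms] by (rule dvdI[OF sym])
qed

lemma conj_class_eq:
  assumes "subgroup H G" "subgroup K G" "conj_class G H \<inter> conj_class G K \<noteq> {}"
  shows "conj_class G H = conj_class G K"
proof -
  have "conj_class G Y \<in> subgroup_conj_classes G" if "subgroup Y G" for Y
    using that by (auto simp: subgroup_conj_classes_eq)
  then show ?thesis
    using group_action.disjoint_union[OF action_by_conjugation_on_subgroups_set] assms
    unfolding subgroup_conj_classes_def by blast
qed

lemma conj_class_subgroup: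
  assumes "subgroup H G" "K \<in> conj_class G H"
  shows "subgroup K G"
  using assms subgroup_conjugation_is_surj2 by (auto simp: conj_class_def conj_set_eq)

lemma normal_conj_image:
  assumes "N \<lhd> G" "g \<in> carrier G"
  shows "(\<lambda>h. g \<otimes> h \<otimes> inv g) ` N = N"
proof -
  interpret N: normal N G by fact
  have "h \<in> (\<lambda>h. g \<otimes> h \<otimes> inv g) ` N" if "h \<in> N" for h
  proof (rule image_eqI)
    show "inv g \<otimes> h \<otimes> g \<in> N" using that assms N.inv_op_closed1 by blast
    show "h = g \<otimes> (inv g \<otimes> h \<otimes> g) \<otimes> inv g"
      using that assms(2) conjugation_is_surj[of g h] N.mem_carrier by simp
  qed
  then show ?thesis using assms N.inv_op_closed2 by auto
qed

lemma normal_iff_card_conj_class: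
  assumes H: "subgroup H G"
  shows "H \<lhd> G \<longleftrightarrow> card (conj_class G H) = 1"
proof
  assume "H \<lhd> G"
  then have "conj_class G H = {H}"
    using normal_conj_image carrier_not_empty by (auto simp: conj_class_def)
  then show "card (conj_class G H) = 1" by simp
next
  assume "card (conj_class G H) = 1"
  then have "conj_class G H = {H}" using conj_class_self[OF H] by (metis card_1_singletonE singletonD)
  moreover have "(\<lambda>h. g \<otimes> h \<otimes> inv g) ` H \<in> conj_class G H" if "g \<in> carrier G" for g
    using that unfolding conj_class_def by (rule imageI)
  ultimately have "(\<lambda>h. g \<otimes> h \<otimes> inv g) ` H = H" if "g \<in> carrier G" for g
    using that by simp
  then show "H \<lhd> G" by (intro normal_invI[OF H]) (metis imageI)
qed

lemma sum_card_conj_classes: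
  assumes "finite (carrier G)"
  shows "(\<Sum>c\<in>conj_class G ` {H. subgroup H G}. card c) = card {H. subgroup H G}"
proof -
  have "(\<Union> (conj_class G ` {H. subgroup H G})) = {H. subgroup H G}"
    (is "?U = ?L")
  proof (intro equalityI subsetI)
    fix K assume "K \<in> ?U"
    then obtain H where "subgroup H G" "K \<in> conj_class G H" by auto
    then show "K \<in> ?L" using conj_class_subgroup by simp
  next
    fix H assume "H \<in> ?L"
    then show "H \<in> ?U" using conj_class_self[of H] by auto
  qed
  moreover have "card (\<Union> (conj_class G ` {H. subgroup H G})) = (\<Sum>c\<in>conj_class G ` {H. subgroup H G}. card c)"
  proof (rule card_Union_disjoint)
    show "pairwise disjnt (conj_class G ` {H. subgroup H G})"
      unfolding pairwise_def disjnt_def using conj_class_eq by auto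
    show "finite c" if "c \<in> conj_class G ` {H. subgroup H G}" for c
      using that assms by (auto simp: conj_class_def)
  qed
  ultimately show ?thesis by simp
qed

text \<open>The hypothesis \<open>2/3 < d'\<close> says that \<open>2 |c| - 3\<close> has negative sum over the classes \<open>c\<close>,
  and only the classes of normal subgroups contribute negative terms, namely \<open>-1\<close> each.\<close>

lemma d_prime_bound:
  assumes fin: "finite (carrier G)" and d: "d_prime G > 2/3"
    and T: "\<And>H. H \<in> T \<Longrightarrow> subgroup H G" "inj_on (conj_class G) T"
      "\<And>H. H \<in> T \<Longrightarrow> 3 \<le> card (conj_class G H)"
  shows "3 * card T < card {N. N \<lhd> G}"
proof -
  define C where "C = conj_class G ` {H. subgroup H G}"
  define C1 where "C1 = {c \<in> C. card c = 1}"
  define C3 where "C3 = conj_class G ` T"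
  have finC: "finite C" unfolding C_def using finite_subgroups[OF fin] by simp
  have sub: "C1 \<subseteq> C" "C3 \<subseteq> C" unfolding C1_def C3_def C_def using T by auto
  have disj: "C1 \<inter> C3 = {}" unfolding C1_def C3_def using T(3) by force
  have pos: "card c \<ge> 1" if "c \<in> C" for c
  proof -
    have "finite c" "c \<noteq> {}" using that fin unfolding C_def conj_class_def by auto
    then show ?thesis by (simp add: Suc_leI card_gt_0_iff)
  qed
  have "card {H. subgroup H G} > 0"
    using finite_subgroups[OF fin] subgroup_self by (auto simp: card_gt_0_iff)
  then have "2 * card {H. subgroup H G} < 3 * card C"
    using d unfolding d_prime_eq C_def[symmetric] by (simp add: field_simps)
  then have neg: "(\<Sum>c\<in>C. 2 * int (card c) - 3) < 0"
    using sum_card_conj_classes[OF fin]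
    by (simp add: sum_subtractf C_def flip: sum_distrib_left of_nat_sum)
  \<comment> \<open>Termwise, 2 |c| - 3 is -1 for |c| = 1, is 1 for |c| = 2 (where 0 is enough), and
    is at least 3 on the classes coming from \<open>T\<close>.\<close>
  have "(\<Sum>c\<in>C. (if c \<in> C3 then 3 else 0) - (if c \<in> C1 then 1 else 0)) \<le> (\<Sum>c\<in>C. 2 * int (card c) - 3)"
  proof (rule sum_mono)
    fix c assume c: "c \<in> C"
    consider "c \<in> C1" | "c \<in> C3" | "c \<notin> C1" "c \<notin> C3" by blast
    then show "(if c \<in> C3 then 3 else 0) - (if c \<in> C1 then 1 else 0) \<le> 2 * int (card c) - 3"
    proof cases
      case 1 then show ?thesis using disj by (auto simp: C1_def)
    next
      case 2 then show ?thesis using disj T(3) by (fastforce simp: C3_def)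
    next
      case 3 then show ?thesis using pos[OF c] c by (auto simp: C1_def)
    qed
  qed
  moreover have "(\<Sum>c\<in>C. (if c \<in> C3 then 3 else 0) - (if c \<in> C1 then 1 else 0)) = 3 * int (card C3) - int (card C1)"
    using finC sub by (simp add: sum_subtractf sum.If_cases Int_absorb1)
  ultimately have "3 * card C3 < card C1" using neg by linarith
  moreover have "card C3 = card T" unfolding C3_def using T(2) by (rule card_image)
  moreover have "C1 \<subseteq> (\<lambda>N. {N}) ` {N. N \<lhd> G}"
  proof
    fix c assume "c \<in> C1"
    then obtain H where H: "subgroup H G" "c = conj_class G H" "card c = 1" by (auto simp: C1_def C_def)
    then show "c \<in> (\<lambda>N. {N}) ` {N. N \<lhd> G}"
      using normal_iff_card_conj_class[OF H(1)] conj_class_self[OF H(1)]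
      by (metis (mono_tags, lifting) card_1_singletonE imageI mem_Collect_eq singletonD)
  qed
  then have "card C1 \<le> card {N. N \<lhd> G}"
    by (intro surj_card_le) (auto intro!: finite_subset[OF _ finite_subgroups[OF fin]] dest: normal_imp_subgroup)
  ultimately show ?thesis by linarith
qed

text \<open>A conjugacy class of at most two subgroups is fixed pointwise by the normalizer of either of them.\<close>

lemma small_conj_class_normalizer:
  assumes H: "subgroup H G" and fin: "finite (carrier G)" and small: "card (conj_class G H) < 3"
  shows "\<exists>K. K \<lhd> G \<and> H \<subseteq> K \<and> (\<forall>g\<in>K. \<forall>h\<in>H. g \<otimes> h \<otimes> inv g \<in> H)"
proof -
  define c where "c g Y = (\<lambda>h. g \<otimes> h \<otimes> inv g) ` Y" for g Y
  have cc: "c g (c h Y) = c (g \<otimes> h) Y" if "g \<in> carrier G" "h \<in> carrier G" "Y \<subseteq> carrier G" for g h Y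
    using that by (auto simp: c_def image_image m_assoc inv_mult_group subset_iff intro!: image_cong)
  have c1: "c \<one> Y = Y" if "Y \<subseteq> carrier G" for Y
    using that by (auto simp: c_def subset_iff image_iff)
  have ci: "c (inv g) (c g Y) = Y" "c g (c (inv g) Y) = Y" if "g \<in> carrier G" "Y \<subseteq> carrier G" for g Y
    using that c1 by (simp_all add: cc)
  have sub: "Y \<subseteq> carrier G" if "Y \<in> conj_class G H" for Y
    using conj_class_subgroup[OF H that] by (rule subgroup.subset)
  have mem: "c g H \<in> conj_class G H" if "g \<in> carrier G" for g
    using that by (auto simp: c_def conj_class_def)
  have Hs: "H \<subseteq> carrier G" using H by (rule subgroup.subset)
  define K where "K = {g \<in> carrier G. c g H = H}"
  have subK: "subgroup K G"
  proof (rule subgroupI)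
    show "inv a \<in> K" if "a \<in> K" for a using that ci[of a H] Hs by (auto simp: K_def)
    show "a \<otimes> b \<in> K" if "a \<in> K" "b \<in> K" for a b using that cc[of a b H] Hs by (auto simp: K_def)
  qed (use c1[OF Hs] in \<open>auto simp: K_def\<close>)
  \<comment> \<open>The normalizer \<open>K\<close> of \<open>H\<close> fixes every member of the
    class: if g in \<open>K\<close> moved a conjugate \<open>Y\<close>, then \<open>H\<close>,
    \<open>Y\<close> and the image of \<open>Y\<close> would be three members. Fixing a^-1 H a means
    that a g a^-1 fixes \<open>H\<close>.\<close>
  have "K \<lhd> G"
  proof (rule normal_invI[OF subK])
    fix a g assume a: "a \<in> carrier G" and g: "g \<in> K"
    have gG: "g \<in> carrier G" and gH: "c g H = H" using g by (auto simp: K_def)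
    define Y where "Y = c (inv a) H"
    have Y: "Y \<in> conj_class G H" unfolding Y_def using a mem by simp
    have gX: "c g Y \<in> conj_class G H"
      using a gG Hs mem[of "g \<otimes> inv a"] by (simp add: Y_def cc)
    have "c g Y = Y"
    proof (rule ccontr)
      assume ne: "c g Y \<noteq> Y"
      have "Y \<noteq> H" using ne gH by auto
      moreover have "c g Y \<noteq> H" using \<open>Y \<noteq> H\<close> gH ci(1)[OF gG] sub[OF Y] Hs by metis
      ultimately have "card {H, Y, c g Y} = 3" using ne by simp
      moreover have "{H, Y, c g Y} \<subseteq> conj_class G H" using Y gX conj_class_self[OF H] by simp
      ultimately show False using small card_mono[of "conj_class G H" "{H, Y, c g Y}"] fin
        by (simp add: conj_class_def)
    qed
    then have "c a (c g (c (inv a) H)) = H" using a Hs by (simp add: Y_def ci)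
    then show "a \<otimes> g \<otimes> inv a \<in> K" using a gG Hs by (simp add: K_def cc m_assoc)
  qed
  moreover have "H \<subseteq> K"
  proof
    fix h assume h: "h \<in> H"
    interpret H: subgroup H G by fact
    have "c k H \<subseteq> H" if "k \<in> H" for k using that by (auto simp: c_def)
    then have "c h H \<subseteq> H" "c (inv h) H \<subseteq> H" using h by auto
    moreover have "c h (c (inv h) H) \<subseteq> c h H"
      using \<open>c (inv h) H \<subseteq> H\<close> unfolding c_def[of h] by (rule image_mono)
    ultimately show "h \<in> K" using ci(2)[of h H] h Hs by (auto simp: K_def)
  qed
  ultimately show ?thesis by (intro exI[of _ K]) (auto simp: K_def c_def)
qed

end

subsection \<open>Sections\<close>

lemma (in group_hom) vimage_subgroup:
  assumes "subgroup K H"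
  shows "subgroup {x \<in> carrier G. h x \<in> K} G"
proof -
  interpret K: subgroup K H by fact
  show ?thesis by (rule G.subgroupI) auto
qed

lemma (in group_hom) order_eq_kernel:
  assumes "finite (carrier G)" "h ` carrier G = carrier H"
  shows "order G = order H * card (kernel G H h)"
proof -
  have "order (G Mod kernel G H h) = order H"
    using iso_same_card[OF FactGroup_iso[OF assms(2)]] by (simp add: order_def)
  then show ?thesis
    using G.lagrange_finite[OF assms(1) subgroup_kernel] by (simp add: order_def FactGroup_def)
qed

text \<open>Taking images is a bijection between the subgroups of both groups. One level up, taking
  images of sets of subgroups carries classes to classes, so both cardinalities agree.\<close>

lemma (in group_hom) d_prime_iso:
  assumes "h \<in> iso G H"
  shows "d_prime G = d_prime H"
proof -
  have inj: "inj_on h (carrier G)" and onto: "h ` carrier G = carrier H"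
    using assms by (auto simp: iso_def bij_betw_def)
  have injP: "inj_on ((`) h) (Pow (carrier G))" using inj by (rule inj_on_image_Pow)
  have img: "(`) h ` {K. subgroup K G} = {K. subgroup K H}"
  proof (intro equalityI subsetI)
    fix K assume "K \<in> {K. subgroup K H}"
    then have K: "subgroup K H" by simp
    have "K = h ` {x \<in> carrier G. h x \<in> K}"
      using subgroup.subset[OF K] onto by auto
    then show "K \<in> (`) h ` {K. subgroup K G}" using vimage_subgroup[OF K] by blast
  qed (use subgroup_img_is_subgroup in auto)
  have cc: "conj_class H (h ` K) = (`) h ` conj_class G K" if "subgroup K G" for K
  proof -
    have "h (g \<otimes> k \<otimes> inv g) = h g \<otimes>\<^bsub>H\<^esub> h k \<otimes>\<^bsub>H\<^esub> inv\<^bsub>H\<^esub> h g" if "g \<in> carrier G" "k \<in> K" for g k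
      using that subgroup.mem_carrier[OF \<open>subgroup K G\<close>] by simp
    then show ?thesis
      unfolding conj_class_def image_image onto[symmetric] by (intro image_cong) auto
  qed
  have L: "{K. subgroup K G} \<subseteq> Pow (carrier G)" by (auto dest: subgroup.subset)
  have CL: "conj_class G ` {K. subgroup K G} \<subseteq> Pow (Pow (carrier G))"
    by (auto simp: conj_class_def dest: subgroup.mem_carrier)
  have "conj_class H ` {K. subgroup K H} = (`) ((`) h) ` (conj_class G ` {K. subgroup K G})"
    unfolding img[symmetric] image_image by (rule image_cong) (simp_all add: cc)
  then have "card (conj_class H ` {K. subgroup K H}) = card (conj_class G ` {K. subgroup K G})"
    by (simp only: card_image[OF inj_on_subset[OF inj_on_image_Pow[OF injP] CL]])
  moreover have "card {K. subgroup K H} = card {K. subgroup K G}"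
    using card_image[OF inj_on_subset[OF injP L]] by (simp only: img)
  ultimately show ?thesis by (simp add: d_prime_eq)
qed

lemma d_prime_iso:
  assumes "group G" "group H" "G \<cong> H"
  shows "d_prime G = d_prime H"
proof -
  obtain h where "h \<in> iso G H" using assms(3) by (auto simp: is_iso_def)
  then show ?thesis
    using assms group_hom.d_prime_iso[of G H h] by (simp add: group_hom_def group_hom_axioms_def iso_def)
qed

lemma epi_group_hom: "group G \<Longrightarrow> group H \<Longrightarrow> f \<in> epi G H \<Longrightarrow> group_hom G H f"
  by (simp add: group_hom_def group_hom_axioms_def epi_def)

text \<open>Quotients of a fixed group have carriers of ever higher types. Realizing them on
  \<^typ>\<open>nat\<close> makes it possible to do induction over all sections.\<close>

lemma (in group) exists_nat_quotient:
  assumes "finite (carrier G)" "N \<lhd> G"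
  obtains S :: "nat monoid" and f where "group S" "f \<in> epi G S" "kernel G S f = N"
proof -
  interpret N: normal N G by fact
  obtain e :: "'a set \<Rightarrow> nat" where e: "inj_on e ((#>) N ` carrier G)"
    using finite_imp_inj_to_nat_seg assms(1) by (metis finite_imageI)
  \<comment> \<open>\<open>e\<close> numbers the cosets, and \<open>image_group\<close> moves the
    multiplication to these numbers. All it requires is that the fibres of \<open>f\<close> are the
    cosets of \<open>N\<close>.\<close>
  define f where "f x = e (N #> x)" for x
  have w: "weak_group_morphism f N G"
  proof (rule weak_group_morphismsI[OF assms(2)])
    fix a b assume ab: "a \<in> carrier G" "b \<in> carrier G"
    have "f a = f b \<longleftrightarrow> N #> a = N #> b"
      using ab e by (auto simp: f_def inj_on_def)
    also have "\<dots> \<longleftrightarrow> a \<otimes> inv b \<in> N"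
      using ab N.rcos_module[OF is_group, of b a] N.subgroup_axioms
      by (metis N.rcos_const N.is_subgroup coset_mult_inv1 coset_mult_inv2 is_group local.inv_closed
          m_closed N.subset coset_join1 coset_join2)
    finally show "f a = f b \<longleftrightarrow> a \<otimes> inv b \<in> N" .
  qed
  have "f \<in> hom G (image_group f G)" using w by (rule weak_group_morphism_is_hom)
  moreover have "f ` carrier G = carrier (image_group f G)" by (simp add: image_group_carrier)
  ultimately show thesis
    using that[of "image_group f G" f] w
    by (simp add: epi_def image_group_is_group weak_group_morphism_ker)
qed

text \<open>A section is presented by a surjection from a subgroup onto a group on \<^typ>\<open>nat\<close>.\<close>

definition conj_dense :: "('a, 'b) monoid_scheme \<Rightarrow> bool" where
  "conj_dense G \<longleftrightarrow> (\<forall>H (S :: nat monoid) f. subgroup H G \<and> group S \<and> f \<in> epi (G\<lparr>carrier := H\<rparr>) S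
     \<longrightarrow> d_prime S > 2/3)"

lemma (in group) conj_dense_subgroup:
  assumes "conj_dense G" "subgroup H G"
  shows "conj_dense (G\<lparr>carrier := H\<rparr>)"
  using assms incl_subgroup[OF assms(2)] by (auto simp: conj_dense_def)

text \<open>A section of the image is a section of \<open>G\<close>: pull the subgroup back along
  \<open>h\<close> and compose the surjections.\<close>

lemma (in group_hom) conj_dense_image:
  assumes "conj_dense G" "h ` carrier G = carrier H"
  shows "conj_dense H"
  unfolding conj_dense_def
proof (intro allI impI, elim conjE)
  fix K f and S :: "nat monoid"
  assume K: "subgroup K H" and S: "group S" and f: "f \<in> epi (H\<lparr>carrier := K\<rparr>) S"
  define L where "L = {x \<in> carrier G. h x \<in> K}"
  have L: "subgroup L G" unfolding L_def using K by (rule vimage_subgroup)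
  have hL: "h ` L = K" using subgroup.subset[OF K] assms(2) by (auto simp: L_def)
  have "h \<in> epi (G\<lparr>carrier := L\<rparr>) (H\<lparr>carrier := K\<rparr>)"
    using hL subgroup.mem_carrier[OF L] by (auto simp: epi_def hom_def)
  then have "f \<circ> h \<in> epi (G\<lparr>carrier := L\<rparr>) S"
    using f by (rule epi_compose)
  then show "d_prime S > 2/3" using assms(1) L S unfolding conj_dense_def by blast
qed

lemma (in group) conj_dense_d_prime:
  assumes "conj_dense G" "finite (carrier G)"
  shows "d_prime G > 2/3"
proof -
  obtain S :: "nat monoid" and f where S: "group S" "f \<in> epi G S" "kernel G S f = {\<one>}"
    using exists_nat_quotient[OF assms(2) one_is_normal] .
  interpret f: group_hom G S f using S by (intro epi_group_hom) auto
  have "f \<in> iso G S"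
    using S f.inj_iff_trivial_ker by (auto simp: epi_def iso_def bij_betw_def)
  moreover have "d_prime S > 2/3"
    using assms(1)[unfolded conj_dense_def, rule_format, of "carrier G" S f] S subgroup_self by simp
  ultimately show ?thesis using f.d_prime_iso by simp
qed

text \<open>By the isomorphism theorem the target \<open>S\<close> of a surjection from
  \<open>K\<close> is \<open>K\<close> modulo the kernel, one of the sections over which the minimum
  is taken.\<close>

lemma (in group) d_star_imp_conj_dense:
  assumes fin: "finite (carrier G)" and d: "d_star G > 2/3"
  shows "conj_dense G"
  unfolding conj_dense_def
proof (intro allI impI, elim conjE)
  fix K f and S :: "nat monoid"
  assume K: "subgroup K G" and S: "group S" and f: "f \<in> epi (G\<lparr>carrier := K\<rparr>) S"
  interpret f: group_hom "G\<lparr>carrier := K\<rparr>" S f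
    using f S subgroup_imp_group[OF K] by (intro epi_group_hom)
  define N where "N = kernel (G\<lparr>carrier := K\<rparr>) S f"
  have N: "N \<lhd> (G\<lparr>carrier := K\<rparr>)" unfolding N_def by (rule f.normal_kernel)
  have "(G\<lparr>carrier := K\<rparr>) Mod N \<in> group_sections G" using K N by (auto simp: group_sections_def)
  then have "d_star G \<le> d_prime ((G\<lparr>carrier := K\<rparr>) Mod N)"
    unfolding d_star_def using finite_group_sections[OF fin] by (intro Min_le) auto
  moreover have "(G\<lparr>carrier := K\<rparr>) Mod N \<cong> S"
    unfolding N_def using f by (intro f.FactGroup_iso) (simp add: epi_def)
  then have "d_prime ((G\<lparr>carrier := K\<rparr>) Mod N) = d_prime S"
    using normal.factorgroup_is_group[OF N] S by (intro d_prime_iso)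
  ultimately show "d_prime S > 2/3" using d by simp
qed

subsection \<open>Sylow subgroups and elements of coprime orders\<close>

context group begin

lemma card_subgroup_dvd: "subgroup H G \<Longrightarrow> card H dvd order G"
  using lagrange[of H] by (metis dvd_triv_right)

lemma card_subgroup_dvd_subgroup:
  assumes "subgroup H G" "subgroup K G" "H \<subseteq> K"
  shows "card H dvd card K"
  using group.card_subgroup_dvd[OF subgroup_imp_group[OF assms(2)] subgroup_incl[OF assms]]
  by (simp add: order_def)

lemma finite_subgroup: "finite (carrier G) \<Longrightarrow> subgroup H G \<Longrightarrow> finite H"
  by (meson finite_subset subgroup.subset)

text \<open>Every induction reaches its quotients through this lemma: the strict inequality feeds
  the induction hypothesis, the divisibility keeps prime power orders.\<close>

lemma exists_smaller_nat_quotient: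
  assumes fin: "finite (carrier G)" and N: "N \<lhd> G" "N \<noteq> {\<one>}"
  obtains T :: "nat monoid" and f where "group_hom G T f" "f ` carrier G = carrier T" "kernel G T f = N"
    "finite (carrier T)" "order T < order G" "order T dvd order G"
proof -
  obtain T :: "nat monoid" and f where T: "group T" "f \<in> epi G T" "kernel G T f = N"
    using exists_nat_quotient[OF fin N(1)] .
  interpret f: group_hom G T f using T by (intro epi_group_hom) auto
  interpret N: normal N G by fact
  have onto: "f ` carrier G = carrier T" using T(2) by (simp add: epi_def)
  have finT: "finite (carrier T)" using fin by (metis onto finite_imageI)
  have ord: "order G = order T * card N" using f.order_eq_kernel[OF fin onto] T(3) by simp
  have "card N \<noteq> 1" using N(2) N.one_closed by (metis card_1_singletonE singletonD)
  moreover have "card N \<noteq> 0" using finite_subgroup[OF fin N.is_subgroup] N.one_closed by (metis card_0_eq empty_iff)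
  moreover have "order T > 0" using finT f.H.order_gt_0_iff_finite by simp
  ultimately have "order T < order G" using ord by simp
  then show thesis using that f.group_hom_axioms onto T(3) finT ord by simp
qed

lemma ord_dvd_card_subgroup:
  assumes "subgroup H G" "x \<in> H"
  shows "ord x dvd card H"
proof -
  have x: "x \<in> carrier G" using assms by (rule subgroup.mem_carrier)
  have "generate G {x} \<subseteq> H" using assms by (intro generate_subgroup_incl) auto
  then show ?thesis
    using card_subgroup_dvd_subgroup[OF generate_is_subgroup assms(1), of "{x}"] x
    by (simp add: generate_pow_card)
qed

lemma ord_subgroup:
  assumes "subgroup H G" "x \<in> H"
  shows "group.ord (G\<lparr>carrier := H\<rparr>) x = ord x"
proof -
  interpret H: group "G\<lparr>carrier := H\<rparr>" using assms(1) by (rule subgroup_imp_group)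
  have x: "x \<in> carrier G" using assms by (rule subgroup.mem_carrier)
  show ?thesis
    using assms(2) x by (subst H.ord_unique) (auto simp: pow_eq_id simp flip: nat_pow_consistent)
qed

lemma cyclic_subgroup: "x \<in> carrier G \<Longrightarrow> subgroup (generate G {x}) G"
  by (intro generate_is_subgroup) auto

lemma generate_sing_self: "x \<in> generate G {x}"
  by (rule generate.incl) simp

lemma generate_singE:
  assumes "finite (carrier G)" "x \<in> carrier G" "y \<in> generate G {x}"
  obtains k :: nat where "y = x [^] k"
  using assms generate_pow_on_finite_carrier[of x] by auto

lemma pow_mem_generate: "x \<in> carrier G \<Longrightarrow> x [^] (k::nat) \<in> generate G {x}"
  by (induction k) (auto intro: generate.intros)

lemma pow_comm:
  assumes "x \<in> carrier G" "y \<in> carrier G" "x \<otimes> y = y \<otimes> x"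
  shows "x [^] (k::nat) \<otimes> y = y \<otimes> x [^] k"
  using group_commutes_pow[OF assms(3,1,2)] .

lemma pow_conj:
  assumes "x \<in> carrier G" "g \<in> carrier G"
  shows "(g \<otimes> x \<otimes> inv g) [^] (n::nat) = g \<otimes> x [^] n \<otimes> inv g"
proof (induction n)
  case (Suc n)
  have "(g \<otimes> x [^] n \<otimes> inv g) \<otimes> (g \<otimes> x \<otimes> inv g) = g \<otimes> x [^] n \<otimes> (inv g \<otimes> g) \<otimes> x \<otimes> inv g"
    using assms by (simp only: m_assoc m_closed inv_closed nat_pow_closed)
  then show ?case using assms Suc by (simp add: m_assoc)
qed (use assms in simp)

lemma ord_conj:
  assumes "x \<in> carrier G" "g \<in> carrier G"
  shows "ord (g \<otimes> x \<otimes> inv g) = ord x"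
proof -
  have "g \<otimes> y \<otimes> inv g = \<one> \<longleftrightarrow> y = \<one>" if "y \<in> carrier G" for y
    using assms that by (simp add: inv_solve_right')
  then show ?thesis using assms by (subst ord_unique) (auto simp: pow_conj pow_eq_id)
qed

lemma centralizer_subgroup:
  assumes "z \<in> carrier G"
  shows "subgroup {g \<in> carrier G. g \<otimes> z = z \<otimes> g} G" (is "subgroup ?Z G")
proof (rule subgroupI)
  show "inv a \<in> ?Z" if "a \<in> ?Z" for a
    using that assms by (simp add: inv_solve_left' inv_solve_right' m_assoc)
       (metis inv_solve_right inv_closed m_assoc m_closed)
  show "a \<otimes> b \<in> ?Z" if "a \<in> ?Z" "b \<in> ?Z" for a b
    using that assms by (simp add: m_assoc) (simp add: m_assoc[symmetric])
qed (use assms in auto)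

lemma central_generate_normal:
  assumes fin: "finite (carrier G)" and z: "z \<in> carrier G"
    and central: "\<And>g. g \<in> carrier G \<Longrightarrow> g \<otimes> z = z \<otimes> g"
  shows "generate G {z} \<lhd> G" "\<And>w g. w \<in> generate G {z} \<Longrightarrow> g \<in> carrier G \<Longrightarrow> g \<otimes> w = w \<otimes> g"
proof -
  show comm: "g \<otimes> w = w \<otimes> g" if w: "w \<in> generate G {z}" and g: "g \<in> carrier G" for w g
  proof -
    obtain k where "w = z [^] (k::nat)" by (rule generate_singE[OF fin z w])
    then show ?thesis using pow_comm[OF z g central[OF g, symmetric]] by simp
  qed
  show "generate G {z} \<lhd> G"
  proof (rule normal_invI[OF cyclic_subgroup[OF z]])
    fix g w assume gw: "g \<in> carrier G" "w \<in> generate G {z}"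
    have "w \<in> carrier G" using cyclic_subgroup[OF z] gw(2) by (rule subgroup.mem_carrier)
    then have "g \<otimes> w \<otimes> inv g = w" using comm[OF gw(2,1)] gw(1) by (simp add: inv_solve_right')
    then show "g \<otimes> w \<otimes> inv g \<in> generate G {z}" using gw by simp
  qed
qed

lemma coprime_powers_eq_one:
  assumes "x \<in> carrier G" "x [^] (m::nat) = \<one>" "x [^] (n::nat) = \<one>" "coprime m n"
  shows "x = \<one>"
proof -
  have "ord x dvd m" "ord x dvd n" using assms by (auto simp: pow_eq_id)
  then have "ord x = 1" using assms(4) by (metis coprime_common_divisor_nat)
  then show ?thesis using ord_eq_1 assms(1) by blast
qed

lemma subgroup_coprime_Int:
  assumes "subgroup H G" "subgroup K G" "coprime (card H) (card K)"
  shows "H \<inter> K = {\<one>}"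
proof -
  have "x = \<one>" if "x \<in> H" "x \<in> K" for x
  proof (rule coprime_powers_eq_one[OF _ _ _ assms(3)])
    show "x \<in> carrier G" using assms(1) that(1) by (rule subgroup.mem_carrier)
    then show "x [^] card H = \<one>" "x [^] card K = \<one>"
      using that assms by (simp_all add: pow_eq_id ord_dvd_card_subgroup)
  qed
  then show ?thesis using assms(1,2) by (auto intro: subgroup.one_closed)
qed

lemma card_set_mult_le:
  assumes "finite H" "finite K"
  shows "card (H <#> K) \<le> card H * card K"
proof -
  have "H <#> K = (\<lambda>(h, k). h \<otimes> k) ` (H \<times> K)" by (auto simp: set_mult_def)
  then show ?thesis using assms card_image_le[of "H \<times> K" "\<lambda>(h, k). h \<otimes> k"] by (simp add: card_cartesian_product)
qed

lemma card_set_mult_disjoint: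
  assumes "subgroup H G" "subgroup K G" "H \<inter> K = {\<one>}"
  shows "card (H <#> K) = card H * card K"
proof -
  have "inj_on (\<lambda>(h, k). h \<otimes> k) (H \<times> K)"
  proof (rule inj_onI, clarify)
    fix h k h' k' assume m: "h \<in> H" "k \<in> K" "h' \<in> H" "k' \<in> K" and eq: "h \<otimes> k = h' \<otimes> k'"
    have c: "h \<in> carrier G" "h' \<in> carrier G" "k \<in> carrier G" "k' \<in> carrier G"
      using m assms(1,2) subgroup.mem_carrier by metis+
    have "h \<otimes> k \<otimes> inv k = h' \<otimes> k' \<otimes> inv k" using eq by simp
    then have "h = h' \<otimes> (k' \<otimes> inv k)" using c by (simp add: m_assoc)
    then have "inv h' \<otimes> h = k' \<otimes> inv k" using c by (simp add: m_assoc[symmetric])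
    moreover have "inv h' \<otimes> h \<in> H" "k' \<otimes> inv k \<in> K"
      using m assms(1,2) by (simp_all add: subgroupE)
    ultimately have "inv h' \<otimes> h = \<one>" "k' \<otimes> inv k = \<one>" using assms(3) by auto
    then show "h = h' \<and> k = k'" using c
      by (metis inv_closed inv_equality inv_inv)
  qed
  moreover have "H <#> K = (\<lambda>(h, k). h \<otimes> k) ` (H \<times> K)" by (auto simp: set_mult_def)
  ultimately show ?thesis by (simp add: card_image card_cartesian_product)
qed

lemma mem_set_mult: "x \<in> H <#> K \<longleftrightarrow> (\<exists>h\<in>H. \<exists>k\<in>K. x = h \<otimes> k)"
  by (auto simp: set_mult_def)

lemma subset_set_mult:
  assumes "subgroup H G" "subgroup K G"
  shows "H \<subseteq> H <#> K" "K \<subseteq> H <#> K"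
proof -
  show "H \<subseteq> H <#> K"
    using assms subgroup.mem_carrier[OF assms(1)] by (force simp: mem_set_mult intro: subgroup.one_closed)
  show "K \<subseteq> H <#> K"
    using assms subgroup.mem_carrier[OF assms(2)] by (force simp: mem_set_mult intro: subgroup.one_closed)
qed

text \<open>Class equation inside \<open>N\<close>: if only \<one> were central, all other orbits
  would have sizes divisible by p, so |N| would be 1 modulo p, although p divides |N|. Taking
  \<open>N\<close> normal instead of the whole group later forces every nontrivial normal subgroup
  to meet the centre.\<close>

lemma p_group_center:
  assumes p: "Factorial_Ring.prime p" and ord: "order G = p ^ n" and N: "N \<lhd> G" "N \<noteq> {\<one>}"
  shows "\<exists>z\<in>N. z \<noteq> \<one> \<and> (\<forall>g\<in>carrier G. g \<otimes> z = z \<otimes> g)"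
proof (rule ccontr)
  assume no: "\<not> ?thesis"
  have fin: "finite (carrier G)" using ord p by (metis order_gt_0_iff_finite prime_gt_0_nat zero_less_power)
  interpret N: normal N G by fact
  define \<phi> where "\<phi> = (\<lambda>g. \<lambda>h \<in> carrier G. g \<otimes> h \<otimes> inv g)"
  interpret \<phi>: group_action G "carrier G" \<phi> unfolding \<phi>_def by (rule action_by_conjugation)
  have orb: "orbit G \<phi> x = {g \<otimes> x \<otimes> inv g | g. g \<in> carrier G}" if "x \<in> carrier G" for x
    using that by (auto simp: orbit_def \<phi>_def)
  define E where "E = orbit G \<phi> ` N"
  have UE: "\<Union>E = N"
  proof (intro equalityI subsetI)
    fix x assume "x \<in> \<Union>E"
    then show "x \<in> N" using N.inv_op_closed2 by (auto simp: E_def orb N.mem_carrier)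
  next
    fix x assume "x \<in> N"
    then show "x \<in> \<Union>E" using \<phi>.orbit_refl[of x] by (auto simp: E_def N.mem_carrier)
  qed
  have finE: "finite E" unfolding E_def using finite_subgroup[OF fin N.is_subgroup] by simp
  have "orbit G \<phi> \<one> = {\<one>}" by (auto simp: orb intro: exI[of _ \<one>])
  then have oneE: "{\<one>} \<in> E" unfolding E_def using N.one_closed by force
  have "card (\<Union>E) = (\<Sum>c\<in>E. card c)"
  proof (rule card_Union_disjoint)
    have "E \<subseteq> orbits G (carrier G) \<phi>" by (auto simp: E_def orbits_def N.mem_carrier)
    then show "pairwise disjnt E" using \<phi>.disjoint_union unfolding pairwise_def disjnt_def by auto
    show "finite c" if "c \<in> E" for c
      using that UE finite_subgroup[OF fin N.is_subgroup] by (metis Union_upper finite_subset)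
  qed
  then have sum: "card N = 1 + (\<Sum>c\<in>E - {{\<one>}}. card c)"
    using finE oneE by (simp add: UE sum.remove)
  have "p dvd card c" if c: "c \<in> E - {{\<one>}}" for c
  proof -
    obtain x where x: "x \<in> N" "c = orbit G \<phi> x" using c by (auto simp: E_def)
    have xG: "x \<in> carrier G" using x by (simp add: N.mem_carrier)
    have self: "x \<in> c" using \<phi>.orbit_refl[OF xG] x by simp
    have "x \<noteq> \<one>" using c x \<open>orbit G \<phi> \<one> = {\<one>}\<close> by auto
    then obtain g where g: "g \<in> carrier G" "g \<otimes> x \<noteq> x \<otimes> g" using no x by blast
    have "g \<otimes> x \<otimes> inv g \<in> c" "g \<otimes> x \<otimes> inv g \<noteq> x"
      using g x xG by (auto simp: orb inv_solve_right')
    then have "card c \<noteq> 1" using self by (metis card_1_singletonE singletonD)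
    moreover have "card c dvd p ^ n"
      using \<phi>.orbit_stabilizer_theorem[OF xG] x ord by (metis dvd_triv_left)
    ultimately show "p dvd card c" using p
      by (metis divides_primepow_nat dvd_power le_zero_eq not_gr_zero power_0)
  qed
  then have "p dvd (\<Sum>c\<in>E - {{\<one>}}. card c)" by (intro dvd_sum)
  moreover have "p dvd card N"
  proof -
    have "card N dvd p ^ n" using card_subgroup_dvd[OF N.is_subgroup] ord by simp
    moreover have "card N \<noteq> 1" using N(2) N.one_closed by (metis card_1_singletonE singletonD)
    ultimately show ?thesis using p
      by (metis divides_primepow_nat dvd_power le_zero_eq not_gr_zero power_0)
  qed
  ultimately have "p dvd 1" using sum by (metis dvd_add_left_iff)
  then show False using p by simp
qed

lemma exists_sylow:
  assumes "finite (carrier G)" "Factorial_Ring.prime p"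
  obtains P where "subgroup P G" "card P = p ^ multiplicity p (order G)"
proof -
  have "p ^ multiplicity p (order G) dvd order G" by (rule multiplicity_dvd)
  then obtain m where "order G = p ^ multiplicity p (order G) * m" by blast
  then show thesis using sylow_thm[OF assms(2) is_group _ assms(1)] that by blast
qed

text \<open>The p-part of the group order divides |H| for each p. This lets a normalizer or
  centralizer be recognized as the whole group one prime at a time.\<close>

lemma subgroup_eq_carrier_if_sylow:
  assumes fin: "finite (carrier G)" and H: "subgroup H G"
    and syl: "\<And>p. Factorial_Ring.prime p \<Longrightarrow>
      \<exists>P. subgroup P G \<and> card P = p ^ multiplicity p (order G) \<and> P \<subseteq> H"
  shows "H = carrier G"
proof -
  have finH: "finite H" "card H \<noteq> 0"
    using finite_subgroup[OF fin H] subgroup.one_closed[OF H] by auto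
  have "order G dvd card H"
  proof (rule multiplicity_le_imp_dvd)
    show "order G \<noteq> 0" using fin by (simp add: order_gt_0_iff_finite[symmetric])
    fix p :: nat assume p: "Factorial_Ring.prime p"
    obtain P where "subgroup P G" "card P = p ^ multiplicity p (order G)" "P \<subseteq> H" using syl[OF p] by blast
    then have "p ^ multiplicity p (order G) dvd card H"
      using card_subgroup_dvd_subgroup[OF _ H] by metis
    then show "multiplicity p (order G) \<le> multiplicity p (card H)"
      using finH p by (intro multiplicity_geI) auto
  qed
  then have "card (carrier G) \<le> card H" using finH(2) by (intro dvd_imp_le) (simp_all add: order_def)
  then show ?thesis using subgroup.subset[OF H] fin by (intro card_seteq)
qed

end

text \<open>For finite groups this is equivalent to nilpotency, but it speaks about pairs of
  elements only, which suits an induction over subgroups and quotients.\<close>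

definition coprime_commute :: "('a, 'b) monoid_scheme \<Rightarrow> bool" where
  "coprime_commute G \<longleftrightarrow> (\<forall>x\<in>carrier G. \<forall>y\<in>carrier G.
     coprime (group.ord G x) (group.ord G y) \<longrightarrow> x \<otimes>\<^bsub>G\<^esub> y = y \<otimes>\<^bsub>G\<^esub> x)"

lemma (in group) coprime_commute_subgroup_iff:
  assumes "subgroup H G"
  shows "coprime_commute (G\<lparr>carrier := H\<rparr>) \<longleftrightarrow>
    (\<forall>x\<in>H. \<forall>y\<in>H. coprime (ord x) (ord y) \<longrightarrow> x \<otimes> y = y \<otimes> x)"
  using ord_subgroup[OF assms] by (simp add: coprime_commute_def)

lemma (in group_hom) ord_hom_dvd: "x \<in> carrier G \<Longrightarrow> H.ord (h x) dvd G.ord x"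
  by (simp flip: H.pow_eq_id hom_nat_pow)

lemma (in group) commutator_eq_one_iff:
  assumes "x \<in> carrier G" "y \<in> carrier G"
  shows "x \<otimes> y \<otimes> inv x \<otimes> inv y = \<one> \<longleftrightarrow> x \<otimes> y = y \<otimes> x"
proof -
  have "x \<otimes> y \<otimes> inv x \<otimes> inv y = (x \<otimes> y) \<otimes> inv (y \<otimes> x)"
    using assms by (simp add: inv_mult_group m_assoc)
  then show ?thesis using assms by (simp add: inv_solve_right')
qed

lemma (in group_hom) commutator_mem_kernel_iff:
  assumes "x \<in> carrier G" "y \<in> carrier G"
  shows "x \<otimes> y \<otimes> inv x \<otimes> inv y \<in> kernel G H h \<longleftrightarrow> h x \<otimes>\<^bsub>H\<^esub> h y = h y \<otimes>\<^bsub>H\<^esub> h x"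
  using assms H.commutator_eq_one_iff[of "h x" "h y"] by (simp add: kernel_def)

text \<open>Orders of images divide the original orders, so coprimality survives in the
  quotient.\<close>

lemma (in group_hom) coprime_commute_kernel:
  assumes "coprime_commute H" "x \<in> carrier G" "y \<in> carrier G" "coprime (G.ord x) (G.ord y)"
  shows "x \<otimes> y \<otimes> inv x \<otimes> inv y \<in> kernel G H h"
proof -
  have "coprime (H.ord (h x)) (H.ord (h y))"
    using assms ord_hom_dvd by (meson coprime_divisors)
  then have "h x \<otimes>\<^bsub>H\<^esub> h y = h y \<otimes>\<^bsub>H\<^esub> h x"
    using assms(1) hom_closed[OF assms(2)] hom_closed[OF assms(3)] unfolding coprime_commute_def by blast
  then show ?thesis using assms by (simp add: commutator_mem_kernel_iff)
qed

context group begin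

lemma sylow_commute:
  assumes cc: "coprime_commute G" and "subgroup P G" "card P = p ^ a" "subgroup Q G" "card Q = q ^ b"
    and "Factorial_Ring.prime p" "Factorial_Ring.prime q" "p \<noteq> q" "x \<in> P" "y \<in> Q"
  shows "x \<otimes> y = y \<otimes> x"
proof -
  have "coprime (p ^ a) (q ^ b)" using assms by (simp add: primes_coprime)
  then have "coprime (ord x) (ord y)"
    using assms ord_dvd_card_subgroup by (metis coprime_divisors)
  then show ?thesis using assms by (auto simp: coprime_commute_def dest: subgroup.mem_carrier)
qed

text \<open>The normalizer of a Sylow p-subgroup contains that subgroup, and for q different from p
  it contains any Sylow q-subgroup, which even centralizes it. Hence it is the whole group.\<close>

lemma exists_normal_sylow:
  assumes fin: "finite (carrier G)" and cc: "coprime_commute G" and p: "Factorial_Ring.prime p"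
  obtains P where "P \<lhd> G" "card P = p ^ multiplicity p (order G)"
proof -
  obtain P where P: "subgroup P G" "card P = p ^ multiplicity p (order G)"
    using exists_sylow[OF fin p] .
  have Pc: "P \<subseteq> carrier G" using P(1) by (rule subgroup.subset)
  have norm: "g \<in> normalizer G P \<longleftrightarrow> g \<in> carrier G \<and> (\<lambda>h. g \<otimes> h \<otimes> inv g) ` P = P" for g
    using Pc by (auto simp: normalizer_def stabilizer_def conj_set_eq)
  have "normalizer G P = carrier G"
  proof (rule subgroup_eq_carrier_if_sylow[OF fin normalizer_imp_subgroup[OF Pc]])
    fix q :: nat assume q: "Factorial_Ring.prime q"
    show "\<exists>Q. subgroup Q G \<and> card Q = q ^ multiplicity q (order G) \<and> Q \<subseteq> normalizer G P"
    proof (cases "q = p")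
      case True
      have "P \<subseteq> normalizer G P"
      proof
        fix x assume x: "x \<in> P"
        interpret GP: group "G\<lparr>carrier := P\<rparr>" using P(1) by (rule subgroup_imp_group)
        have "(\<lambda>h. x \<otimes> h \<otimes> inv x) ` P = P"
          using GP.normal_conj_image[OF GP.normal_self, of x] x P(1) by (simp add: m_inv_consistent)
        then show "x \<in> normalizer G P" using x Pc by (auto simp: norm)
      qed
      then show ?thesis using P True by auto
    next
      case False
      obtain Q where Q: "subgroup Q G" "card Q = q ^ multiplicity q (order G)"
        using exists_sylow[OF fin q] .
      have "(\<lambda>h. x \<otimes> h \<otimes> inv x) ` P = P" if x: "x \<in> Q" for x
      proof -
        have xc: "x \<in> carrier G" using Q(1) x by (rule subgroup.mem_carrier)
        have "x \<otimes> h \<otimes> inv x = h" if "h \<in> P" for h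
          using sylow_commute[OF cc Q P q p False x that] xc that Pc by (auto simp: m_assoc)
        then show ?thesis by simp
      qed
      then have "Q \<subseteq> normalizer G P" using subgroup.mem_carrier[OF Q(1)] by (auto simp: norm)
      then show ?thesis using Q by blast
    qed
  qed
  then have "P \<lhd> G" using norm by (intro normal_invI[OF P(1)]) blast
  then show thesis using P that by blast
qed

text \<open>A nontrivial central element z of one Sylow p-subgroup \<open>P\<close> works. Its
  centralizer contains \<open>P\<close> by choice, and Sylow subgroups for other primes because they
  commute with \<open>P\<close> elementwise.\<close>

lemma coprime_commute_center:
  assumes fin: "finite (carrier G)" and cc: "coprime_commute G" and nontriv: "carrier G \<noteq> {\<one>}"
  obtains z where "z \<in> carrier G" "z \<noteq> \<one>" "\<And>g. g \<in> carrier G \<Longrightarrow> g \<otimes> z = z \<otimes> g"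
proof -
  have "order G \<noteq> 1" using nontriv fin order_one_triv_iff by simp
  then obtain p where p: "Factorial_Ring.prime p" "p dvd order G" using prime_factor_nat by blast
  obtain P where P: "subgroup P G" "card P = p ^ multiplicity p (order G)"
    using exists_sylow[OF fin p(1)] .
  interpret P: group "G\<lparr>carrier := P\<rparr>" using P(1) by (rule subgroup_imp_group)
  have "order G \<noteq> 0" using fin order_gt_0_iff_finite by simp
  then have "multiplicity p (order G) > 0" using p by (simp add: prime_multiplicity_gt_zero_iff)
  then have "card P \<noteq> 1" using P p prime_gt_1_nat[of p] by (metis nat_power_eq_Suc_0_iff One_nat_def less_irrefl)
  then have "P \<noteq> {\<one>}" by auto
  then have "\<exists>z\<in>P. z \<noteq> \<one> \<and> (\<forall>g\<in>P. g \<otimes> z = z \<otimes> g)"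
    using P.p_group_center[OF p(1) _ P.normal_self] P(2) unfolding order_def by simp
  then obtain z where z: "z \<in> P" "z \<noteq> \<one>" "\<And>g. g \<in> P \<Longrightarrow> g \<otimes> z = z \<otimes> g" by blast
  have zc: "z \<in> carrier G" using P(1) z(1) by (rule subgroup.mem_carrier)
  define Z where "Z = {g \<in> carrier G. g \<otimes> z = z \<otimes> g}"
  have Z: "subgroup Z G" unfolding Z_def using zc by (rule centralizer_subgroup)
  have "Z = carrier G"
  proof (rule subgroup_eq_carrier_if_sylow[OF fin Z])
    fix q :: nat assume q: "Factorial_Ring.prime q"
    show "\<exists>Q. subgroup Q G \<and> card Q = q ^ multiplicity q (order G) \<and> Q \<subseteq> Z"
    proof (cases "q = p")
      case True
      then show ?thesis using P z subgroup.mem_carrier[OF P(1)] by (auto simp: Z_def)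
    next
      case False
      obtain Q where Q: "subgroup Q G" "card Q = q ^ multiplicity q (order G)"
        using exists_sylow[OF fin q] .
      have "Q \<subseteq> Z"
        using sylow_commute[OF cc Q P q p(1) False _ z(1)] subgroup.mem_carrier[OF Q(1)] by (auto simp: Z_def)
      then show ?thesis using Q by blast
    qed
  qed
  then show thesis using that z zc by (auto simp: Z_def)
qed

text \<open>Modulo \<open>P\<close> the group order is prime to p, so an element of p-power order
  becomes trivial. Thus \<open>P\<close> is exactly the set of p-elements and is preserved by every
  conjugation from a larger group.\<close>

lemma normal_sylow_mem:
  assumes fin: "finite (carrier G)" and p: "Factorial_Ring.prime p"
    and P: "P \<lhd> G" "card P = p ^ multiplicity p (order G)"
    and x: "x \<in> carrier G" "ord x dvd p ^ k"
  shows "x \<in> P"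
proof -
  interpret P: normal P G by fact
  interpret Q: group "G Mod P" by (rule P.factorgroup_is_group)
  interpret h: group_hom G "G Mod P" "(#>) P"
    using P.r_coset_hom_Mod P.factorgroup_is_group by (simp add: group_hom_def group_hom_axioms_def)
  have "order (G Mod P) * card P = order G"
    using lagrange[OF P.is_subgroup] by (simp add: order_def FactGroup_def)
  then have "\<not> p dvd order (G Mod P)"
    using P(2) fin p multiplicity_decompose[of "order G" p] order_gt_0_iff_finite
    by (metis dvd_mult_div_cancel mult.commute multiplicity_dvd nonzero_mult_div_cancel_right
        not_prime_unit power_eq_0_iff prime_gt_0_nat less_numeral_extra(3))
  then have cop: "coprime (order (G Mod P)) (p ^ k)"
    using p by (metis coprime_commute coprime_power_right_iff prime_imp_coprime)
  have xQ: "P #> x \<in> carrier (G Mod P)" using x(1) by (rule h.hom_closed)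
  have "P #> x = \<one>\<^bsub>G Mod P\<^esub>"
  proof (rule Q.coprime_powers_eq_one[OF xQ _ _ cop])
    show "(P #> x) [^]\<^bsub>G Mod P\<^esub> order (G Mod P) = \<one>\<^bsub>G Mod P\<^esub>"
      using xQ by (rule Q.pow_order_eq_1)
    have "Q.ord (P #> x) dvd p ^ k" using h.ord_hom_dvd[OF x(1)] x(2) by (rule dvd_trans)
    then show "(P #> x) [^]\<^bsub>G Mod P\<^esub> (p ^ k) = \<one>\<^bsub>G Mod P\<^esub>"
      using xQ by (simp only: Q.pow_eq_id)
  qed
  then show ?thesis using x(1) rcos_self[OF x(1) P.is_subgroup] by simp
qed

end

section \<open>Minimal groups in which elements of coprime orders do not commute\<close>

context group begin

text \<open>A minimal group with \<open>d' > 2/3\<close> in which elements of coprime orders do not commute would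
  be an extension \<open>N \<langle>u\<rangle>\<close> of its unique minimal normal subgroup \<open>N\<close>, an \<open>r\<close>-group, by a group of
  prime order \<open>q \<noteq> r\<close>. Its only normal subgroups are then \<open>1\<close>, \<open>N\<close> and the whole group, too few
  to compensate for the conjugates of \<open>\<langle>u\<rangle>\<close>.\<close>

lemma coprime_commute_step:
  assumes fin: "finite (carrier G)" and d: "d_prime G > 2/3"
    and sub: "\<And>H. subgroup H G \<Longrightarrow> H \<noteq> carrier G \<Longrightarrow> coprime_commute (G\<lparr>carrier := H\<rparr>)"
    and quot: "\<And>N x y. N \<lhd> G \<Longrightarrow> N \<noteq> {\<one>} \<Longrightarrow> x \<in> carrier G \<Longrightarrow> y \<in> carrier G \<Longrightarrow>
      coprime (ord x) (ord y) \<Longrightarrow> x \<otimes> y \<otimes> inv x \<otimes> inv y \<in> N"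
  shows "coprime_commute G"
proof (rule ccontr)
  assume "\<not> coprime_commute G"
  then obtain x y where xy: "x \<in> carrier G" "y \<in> carrier G" "coprime (ord x) (ord y)" "x \<otimes> y \<noteq> y \<otimes> x"
    by (auto simp: coprime_commute_def)
  define c where "c = x \<otimes> y \<otimes> inv x \<otimes> inv y"
  have c: "c \<in> carrier G" "c \<noteq> \<one>" using xy by (simp_all add: c_def commutator_eq_one_iff)
  have cN: "c \<in> N" if "N \<lhd> G" "N \<noteq> {\<one>}" for N unfolding c_def using quot that xy by blast
  obtain N where N: "N \<lhd> G" "N \<noteq> {\<one>}" and min: "\<And>K. K \<lhd> G \<Longrightarrow> K \<noteq> {\<one>} \<Longrightarrow> card N \<le> card K"
    using ex_has_least_nat[of "\<lambda>N. N \<lhd> G \<and> N \<noteq> {\<one>}" "carrier G" card] normal_self c by auto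
  interpret N: normal N G by fact
  have finN: "finite N" using finite_subgroup[OF fin N.is_subgroup] .
  have leN: "N \<subseteq> K" if K: "K \<lhd> G" "K \<noteq> {\<one>}" for K
  proof -
    have "c \<in> K \<inter> N" using cN K N by blast
    then have "K \<inter> N \<noteq> {\<one>}" using c by auto
    then have "card N \<le> card (K \<inter> N)" using min normal_subgroup_intersect[OF K(1) N(1)] by blast
    then have "K \<inter> N = N" using finN by (intro card_seteq) auto
    then show ?thesis by blast
  qed
  \<comment> \<open>With at most three normal subgroups a single class of size three is already too
    much, so a normal \<open>K\<close> containing \<langle>u\<rangle> normalizes it. The conditions
    on u leave only the whole group for \<open>K\<close>; then \<langle>u\<rangle> is normal and
    must contain \<open>N\<close>. The guard on \<open>u \<notin> N\<close> lets the same argument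
    cover \<open>N = carrier G\<close>.\<close>
  have big: False
    if few: "\<And>K. K \<lhd> G \<Longrightarrow> K \<in> {{\<one>}, N, carrier G}"
      and u: "u \<in> carrier G" "u \<notin> {\<one>}" "N \<noteq> carrier G \<Longrightarrow> u \<notin> N" "\<not> N \<subseteq> generate G {u}" for u
  proof -
    let ?U = "generate G {u}"
    have U: "subgroup ?U G" using u(1) by (rule cyclic_subgroup)
    have "card {K. K \<lhd> G} \<le> card {{\<one>}, N, carrier G}"
      using few by (intro card_mono) auto
    also have "\<dots> \<le> 3" by (intro order_trans[OF card_insert_le_m1]) (auto simp: card_insert_if)
    finally have "card {K. K \<lhd> G} \<le> 3" .
    then have "card (conj_class G ?U) < 3"
      using d_prime_bound[OF fin d, of "{?U}"] U by force
    then obtain K where K: "K \<lhd> G" "?U \<subseteq> K" "\<forall>g\<in>K. \<forall>h\<in>?U. g \<otimes> h \<otimes> inv g \<in> ?U"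
      using small_conj_class_normalizer[OF U fin] by blast
    have "u \<in> K" using K(2) generate_sing_self by blast
    then have "K = carrier G" using few[OF K(1)] u by blast
    then have "?U \<lhd> G" using K(3) by (intro normal_invI[OF U]) blast
    moreover have "?U \<noteq> {\<one>}" using u(2) generate_sing_self[of u] by blast
    ultimately show False using leN u(4) by blast
  qed
  show False
  proof (cases "N = carrier G")
    case True
    have "y \<noteq> \<one>" using xy by auto
    \<comment> \<open>Here the group is simple. A cyclic subgroup containing \<open>N\<close> would
      be the whole group, and x and y would be powers of one element.\<close>
    have "\<not> N \<subseteq> generate G {x}" "\<not> N \<subseteq> generate G {y}"
    proof -
      have False if g: "N \<subseteq> generate G {u}" and u: "u \<in> {x, y}" for u
      proof -
        have uc: "u \<in> carrier G" using u xy by auto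
        obtain k where "x = u [^] (k::nat)"
          using generate_singE[OF fin uc, of x] g xy True by blast
        moreover obtain l where "y = u [^] (l::nat)"
          using generate_singE[OF fin uc, of y] g xy True by blast
        ultimately show False using xy(4) uc by (simp add: nat_pow_mult add.commute)
      qed
      then show "\<not> N \<subseteq> generate G {x}" "\<not> N \<subseteq> generate G {y}" by auto
    qed
    moreover have "K \<in> {{\<one>}, N, carrier G}" if "K \<lhd> G" for K
      using leN[OF that] True subgroup.subset[OF normal_imp_subgroup[OF that]] by auto
    ultimately show False using big[of y] True xy(2) \<open>y \<noteq> \<one>\<close> by blast
  next
    case False
    have ccN: "coprime_commute (G\<lparr>carrier := N\<rparr>)" using sub[OF N.is_subgroup False] .
    interpret GN: group "G\<lparr>carrier := N\<rparr>" using subgroup_imp_group[OF N.is_subgroup] .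
    have finGN: "finite (carrier (G\<lparr>carrier := N\<rparr>))" using finN by simp
    have "card N \<noteq> 1" using N(2) N.one_closed by (metis card_1_singletonE singletonD)
    then obtain r where r: "Factorial_Ring.prime r" "r dvd card N" using prime_factor_nat by blast
    define m where "m = multiplicity r (card N)"
    obtain P where P: "P \<lhd> (G\<lparr>carrier := N\<rparr>)" "card P = r ^ m"
      using GN.exists_normal_sylow[OF finGN ccN r(1)] by (auto simp: order_def m_def)
    have PN: "subgroup P (G\<lparr>carrier := N\<rparr>)" using P(1) by (rule normal_imp_subgroup)
    have subP: "subgroup P G" using incl_subgroup[OF N.is_subgroup PN] .
    have PsubN: "P \<subseteq> N" using subgroup.subset[OF PN] by simp
    \<comment> \<open>Being the set of all r-elements of \<open>N\<close>, the Sylow subgroup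
      \<open>P\<close> is stable under conjugation by all of \<open>G\<close>. As \<open>N\<close>
      lies in every nontrivial normal subgroup, this forces \<open>N = P\<close>.\<close>
    have "P \<lhd> G"
    proof (rule normal_invI[OF subP])
      fix g h assume g: "g \<in> carrier G" and h: "h \<in> P"
      have hc: "h \<in> carrier G" using subP h by (rule subgroup.mem_carrier)
      have ghN: "g \<otimes> h \<otimes> inv g \<in> N" using N.inv_op_closed2 g h PsubN by blast
      have "ord (g \<otimes> h \<otimes> inv g) dvd r ^ m"
        using ord_conj[OF hc g] ord_dvd_card_subgroup[OF subP h] P(2) by simp
      then show "g \<otimes> h \<otimes> inv g \<in> P"
        using GN.normal_sylow_mem[OF finGN r(1) P(1), of "g \<otimes> h \<otimes> inv g" m] P(2) ghN
          ord_subgroup[OF N.is_subgroup ghN] by (simp add: order_def m_def)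
    qed
    moreover have "P \<noteq> {\<one>}"
    proof -
      have "m > 0" using r finN N.one_closed unfolding m_def
        by (subst prime_multiplicity_gt_zero_iff) (auto simp: card_eq_0_iff intro: N.one_closed)
      then have "card P \<noteq> 1" using P(2) r(1) by (metis One_nat_def nat_power_eq_Suc_0_iff neq0_conv prime_nat_iff less_irrefl)
      then show ?thesis by auto
    qed
    ultimately have "N \<subseteq> P" by (rule leN)
    then have cardN: "card N = r ^ m" using PsubN P(2) by auto
    \<comment> \<open>Since r cannot divide both coprime orders, u is whichever of x and y has order
      prime to r, and v is the other one. Then \<open>N\<close> and \<langle>u\<rangle> have coprime
      orders.\<close>
    have key: False
      if u: "u \<in> carrier G" and v: "v \<in> carrier G" and uv: "coprime (ord v) (ord u)" "v \<otimes> u \<noteq> u \<otimes> v"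
        and nr: "\<not> r dvd ord u" for u v
    proof -
      let ?U = "generate G {u}"
      have U: "subgroup ?U G" using u by (rule cyclic_subgroup)
      have cardU: "card ?U = ord u" using generate_pow_card[OF u] by simp
      have cop: "coprime (card N) (ord u)"
        using r(1) nr cardN by (metis coprime_power_left_iff prime_imp_coprime)
      have NU: "N \<inter> ?U = {\<one>}" using subgroup_coprime_Int[OF N.is_subgroup U] cop cardU by simp
      have cprod: "card (N <#> H) = card N * card H" if "subgroup H G" "H \<subseteq> ?U" for H
      proof -
        have "N \<inter> H = {\<one>}" using NU that N.one_closed subgroup.one_closed[OF that(1)] by blast
        then show ?thesis using card_set_mult_disjoint[OF N.is_subgroup that(1)] by blast
      qed
      \<comment> \<open>If N\<langle>w\<rangle> is proper, it satisfies
        \<open>coprime_commute\<close> by assumption, and n and w have coprime orders.\<close>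
      have comm: "n \<otimes> w = w \<otimes> n"
        if w: "w \<in> ?U" and ne: "N <#> generate G {w} \<noteq> carrier G" and n: "n \<in> N" for n w
      proof -
        have wc: "w \<in> carrier G" using w U subgroup.mem_carrier by metis
        let ?M = "N <#> generate G {w}"
        have M: "subgroup ?M G" using mult_norm_subgroup[OF N(1) cyclic_subgroup[OF wc]] .
        have "n \<in> ?M" "w \<in> ?M"
          using subset_set_mult[OF N.is_subgroup cyclic_subgroup[OF wc]] n generate_sing_self[of w] by auto
        moreover have "coprime (ord n) (ord w)"
          using cop ord_dvd_card_subgroup[OF N.is_subgroup n] ord_dvd_card_subgroup[OF U w] cardU
          by (metis coprime_divisors)
        ultimately show ?thesis using sub[OF M ne] coprime_commute_subgroup_iff[OF M] by blast
      qed
      \<comment> \<open>Otherwise u commutes with n = [v, u], which lies in \<open>N\<close>. Since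
        n u is a conjugate of u, both have order prime to r, so n^(ord u) = 1 and n = 1 by
        coprimality, against the choice of u and v.\<close>
      have full: "N <#> ?U = carrier G"
      proof (rule ccontr)
        assume ne: "N <#> ?U \<noteq> carrier G"
        define n where "n = v \<otimes> u \<otimes> inv v \<otimes> inv u"
        have n: "n \<in> N" unfolding n_def using quot[OF N v u uv(1)] .
        have nc: "n \<in> carrier G" using n by (rule N.mem_carrier)
        have nu: "n \<otimes> u = u \<otimes> n" using comm[OF generate_sing_self ne n] .
        have "n \<otimes> u = v \<otimes> u \<otimes> inv v" using u v by (simp add: n_def m_assoc)
        then have "(n \<otimes> u) [^] ord u = \<one>"
          using ord_conj[OF u v] pow_ord_eq_1[of "n \<otimes> u"] u v nc by simp
        then have "n [^] ord u = \<one>"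
          using pow_mult_distrib[OF nu nc u, of "ord u"] u nc by simp
        moreover have "n [^] card N = \<one>"
          using ord_dvd_card_subgroup[OF N.is_subgroup n] nc by (simp add: pow_eq_id)
        ultimately have "n = \<one>" using coprime_powers_eq_one[OF nc _ _ cop] by blast
        then show False using uv(2) u v by (simp add: n_def commutator_eq_one_iff)
      qed
      have ordu: "ord u \<noteq> 1" using uv(2) u v ord_eq_1[of u] by auto
      then obtain q where q: "Factorial_Ring.prime q" "q dvd ord u" using prime_factor_nat by blast
      \<comment> \<open>The aim is w = 1, so that u has prime order q. N\<langle>w\<rangle> is too
        small to be everything, so \<open>N\<close> centralizes w, as does u, and w is central. A
        nontrivial \<langle>w\<rangle> would be normal and contain \<open>N\<close>, although
        \<langle>u\<rangle> meets \<open>N\<close> trivially.\<close>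
      define w where "w = u [^] q"
      have w: "w \<in> ?U" "w \<in> carrier G" using pow_mem_generate[OF u] u by (simp_all add: w_def)
      have "ord w = ord u div q" unfolding w_def using u q by (intro ord_pow) (auto simp: prime_gt_0_nat)
      then have ordw: "ord w < ord u"
        using q ord_ge_1[OF fin u] prime_gt_1_nat[OF q(1)] by (simp add: div_less_dividend)
      have "card (N <#> generate G {w}) = card N * ord w"
        using cprod[OF cyclic_subgroup[OF w(2)] generate_subgroup_incl[OF _ U]] w generate_pow_card[OF w(2)] by simp
      moreover have cardG: "card (carrier G) = card N * ord u"
        using cprod[OF U] full cardU by simp
      moreover have "card N > 0" using finN N.one_closed by (metis card_gt_0_iff empty_iff)
      ultimately have neM: "N <#> generate G {w} \<noteq> carrier G" using ordw by force
      have central: "g \<otimes> w = w \<otimes> g" if "g \<in> carrier G" for g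
      proof -
        obtain n k where nk: "n \<in> N" "k \<in> ?U" "g = n \<otimes> k" using full \<open>g \<in> carrier G\<close> by (metis mem_set_mult)
        obtain l where l: "k = u [^] (l::nat)" using generate_singE[OF fin u nk(2)] .
        have "k \<otimes> w = w \<otimes> k" using u by (simp add: l w_def nat_pow_mult add.commute)
        moreover have "n \<otimes> w = w \<otimes> n" using comm[OF w(1) neM nk(1)] .
        moreover have "n \<in> carrier G" "k \<in> carrier G" using nk u l by auto
        ultimately show ?thesis using w(2) by (simp add: nk(3) m_assoc) (simp add: m_assoc[symmetric])
      qed
      have "w = \<one>"
      proof (rule ccontr)
        assume "w \<noteq> \<one>"
        have "generate G {w} \<lhd> G" using central_generate_normal(1)[OF fin w(2) central] .
        moreover have "generate G {w} \<noteq> {\<one>}" using \<open>w \<noteq> \<one>\<close> generate_sing_self[of w] by blast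
        ultimately have "N \<subseteq> generate G {w}" by (rule leN)
        also have "generate G {w} \<subseteq> ?U" using w U by (intro generate_subgroup_incl) auto
        finally show False using NU N(2) N.one_closed by blast
      qed
      then have "ord u dvd q" unfolding w_def using u by (simp add: pow_eq_id)
      then have ordq: "ord u = q" using q ordu by (metis prime_nat_iff)
      \<comment> \<open>A nontrivial normal subgroup contains \<open>N\<close>, whose index is the
        prime q, so nothing lies strictly between.\<close>
      have few: "K \<in> {{\<one>}, N, carrier G}" if K: "K \<lhd> G" for K
      proof (cases "K = {\<one>}")
        case False
        have subK: "subgroup K G" using K by (rule normal_imp_subgroup)
        have NK: "N \<subseteq> K" using leN[OF K False] .
        have finK: "finite K" using finite_subgroup[OF fin subK] .
        obtain t where t: "card K = card N * t"
          using card_subgroup_dvd_subgroup[OF N.is_subgroup subK NK] by blast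
        have "card N * t dvd card N * q"
          using card_subgroup_dvd[OF subK] cardG ordq t by (simp add: order_def)
        then have "t dvd q" using \<open>card N > 0\<close> by simp
        then consider "t = 1" | "t = q" using q(1) by (metis prime_nat_iff)
        then show ?thesis
        proof cases
          case 1
          then have "N = K" using t NK finK by (intro card_seteq) auto
          then show ?thesis by simp
        next
          case 2
          then have "K = carrier G"
            using t cardG ordq fin subgroup.subset[OF subK] by (intro card_seteq) auto
          then show ?thesis by simp
        qed
      qed simp
      have "u \<noteq> \<one>" using ordu by auto
      moreover have "u \<notin> N" using NU generate_sing_self[of u] \<open>u \<noteq> \<one>\<close> by blast
      moreover have "\<not> N \<subseteq> ?U" using NU N(2) N.one_closed by blast
      ultimately show False using big[of u] few u by blast
    qed
    have "\<not> r dvd ord x \<or> \<not> r dvd ord y"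
      using xy(3) r(1) by (metis coprime_common_divisor_nat not_prime_1)
    then show False
    proof
      assume "\<not> r dvd ord x"
      then show False using key[OF xy(1,2)] xy(3,4) by (metis Rings.coprime_commute)
    next
      assume "\<not> r dvd ord y"
      then show False using key[of y x] xy by auto
    qed
  qed
qed

end

text \<open>Subgroups and the copies of quotients both stay on \<open>nat\<close>, so one induction
  on the order supplies both hypotheses of the minimal step.\<close>

lemma conj_dense_imp_coprime_commute_nat:
  fixes S :: "nat monoid"
  assumes "group S" "finite (carrier S)" "conj_dense S"
  shows "coprime_commute S"
  using assms
proof (induction "order S" arbitrary: S rule: less_induct)
  case less
  interpret group S by fact
  show ?case
  proof (rule coprime_commute_step[OF less.prems(2) conj_dense_d_prime[OF less.prems(3,2)]])
    fix H assume H: "subgroup H S" "H \<noteq> carrier S"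
    have "card H < card (carrier S)"
      using H less.prems(2) subgroup.subset[OF H(1)] by (intro psubset_card_mono) auto
    then show "coprime_commute (S\<lparr>carrier := H\<rparr>)"
      using less.hyps[of "S\<lparr>carrier := H\<rparr>"] subgroup_imp_group[OF H(1)] finite_subgroup[OF less.prems(2) H(1)]
        conj_dense_subgroup[OF less.prems(3) H(1)] by (simp add: order_def)
  next
    fix N x y
    assume N: "N \<lhd> S" "N \<noteq> {\<one>\<^bsub>S\<^esub>}" and xy: "x \<in> carrier S" "y \<in> carrier S" "coprime (ord x) (ord y)"
    obtain T :: "nat monoid" and f where f: "group_hom S T f" and T: "f ` carrier S = carrier T" "kernel S T f = N"
      "finite (carrier T)" "order T < order S"
      using exists_smaller_nat_quotient[OF less.prems(2) N] .
    interpret f: group_hom S T f by fact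
    have "coprime_commute T"
      using less.hyps[OF T(4)] f.H.is_group T(3) f.conj_dense_image[OF less.prems(3) T(1)] by blast
    then show "x \<otimes>\<^bsub>S\<^esub> y \<otimes>\<^bsub>S\<^esub> inv\<^bsub>S\<^esub> x \<otimes>\<^bsub>S\<^esub> inv\<^bsub>S\<^esub> y \<in> N"
      using f.coprime_commute_kernel[OF _ xy] T(2) by simp
  qed
qed

lemma (in group) conj_dense_imp_coprime_commute:
  assumes fin: "finite (carrier G)" and d: "conj_dense G"
  shows "coprime_commute G"
proof -
  obtain S :: "nat monoid" and f where S: "group S" "f \<in> epi G S" "kernel G S f = {\<one>}"
    using exists_nat_quotient[OF fin one_is_normal] .
  interpret f: group_hom G S f using S by (intro epi_group_hom) auto
  have onto: "f ` carrier G = carrier S" using S(2) by (simp add: epi_def)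
  have "finite (carrier S)" using fin by (metis onto finite_imageI)
  then have "coprime_commute S"
    using conj_dense_imp_coprime_commute_nat S(1) f.conj_dense_image[OF d onto] by blast
  then have "x \<otimes> y \<otimes> inv x \<otimes> inv y = \<one>"
    if "x \<in> carrier G" "y \<in> carrier G" "coprime (ord x) (ord y)" for x y
    using f.coprime_commute_kernel[of x y] S(3) that by simp
  then show ?thesis using commutator_eq_one_iff unfolding coprime_commute_def by blast
qed

subsection \<open>Nilpotency and the product of the Sylow subgroups\<close>

lemma (in group) lower_central_series_subset: "lower_central_series G n \<subseteq> carrier G"
proof (induction n)
  case (Suc n)
  then show ?case by (auto intro!: generate_incl)
qed simp

lemma (in group_hom) lower_central_series_image:
  "h ` lower_central_series G n \<subseteq> lower_central_series H n"
proof (induction n)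
  case 0
  then show ?case by auto
next
  case (Suc n)
  let ?K = "{x \<otimes> y \<otimes> inv x \<otimes> inv y | x y. x \<in> lower_central_series G n \<and> y \<in> carrier G}"
  let ?L = "{x \<otimes>\<^bsub>H\<^esub> y \<otimes>\<^bsub>H\<^esub> inv\<^bsub>H\<^esub> x \<otimes>\<^bsub>H\<^esub> inv\<^bsub>H\<^esub> y | x y. x \<in> lower_central_series H n \<and> y \<in> carrier H}"
  have K: "?K \<subseteq> carrier G"
    using subsetD[OF G.lower_central_series_subset[of n]] by auto
  have "h ` ?K \<subseteq> ?L"
  proof
    fix z assume "z \<in> h ` ?K"
    then obtain x y where xy: "x \<in> lower_central_series G n" "y \<in> carrier G"
      "z = h (x \<otimes> y \<otimes> inv x \<otimes> inv y)" by blast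
    have "x \<in> carrier G" using xy(1) G.lower_central_series_subset by blast
    then have "z = h x \<otimes>\<^bsub>H\<^esub> h y \<otimes>\<^bsub>H\<^esub> inv\<^bsub>H\<^esub> (h x) \<otimes>\<^bsub>H\<^esub> inv\<^bsub>H\<^esub> (h y)" using xy by simp
    moreover have "h x \<in> lower_central_series H n" using xy Suc by blast
    ultimately show "z \<in> ?L"
      using xy(2) by (intro CollectI exI[of _ "h x"] exI[of _ "h y"] conjI hom_closed)
  qed
  then have "generate H (h ` ?K) \<subseteq> generate H ?L" by (rule H.mono_generate)
  then show ?case using generate_img[OF K] by simp
qed

text \<open>The lower central series of \<open>G\<close> maps into that of \<open>H\<close>. Where
  the latter reaches 1, the former lies in the central kernel, and one more commutator step kills
  it. A trivial kernel is the special case that transfers nilpotency back from a copy.\<close>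

lemma (in group_hom) nilpotent_central_extension:
  assumes "nilpotent_group H"
    and central: "\<And>z g. z \<in> kernel G H h \<Longrightarrow> g \<in> carrier G \<Longrightarrow> z \<otimes> g = g \<otimes> z"
  shows "nilpotent_group G"
proof -
  obtain n where n: "lower_central_series H n = {\<one>\<^bsub>H\<^esub>}" using assms(1) by (auto simp: nilpotent_group_def)
  have sub: "lower_central_series G n \<subseteq> kernel G H h"
    using lower_central_series_image[of n] n G.lower_central_series_subset[of n] by (auto simp: kernel_def)
  let ?K = "{x \<otimes> y \<otimes> inv x \<otimes> inv y | x y. x \<in> lower_central_series G n \<and> y \<in> carrier G}"
  have "?K \<subseteq> {\<one>}"
    using sub central G.lower_central_series_subset[of n] G.commutator_eq_one_iff by blast
  then have "generate G ?K \<subseteq> {\<one>}" by (intro G.generate_subgroup_incl G.triv_subgroup)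
  then have "lower_central_series G (Suc n) = {\<one>}" by (auto intro: generate.one)
  then show ?thesis unfolding nilpotent_group_def using G.is_group by blast
qed

lemma conj_dense_imp_nilpotent_nat:
  fixes S :: "nat monoid"
  assumes "group S" "finite (carrier S)" "conj_dense S"
  shows "nilpotent_group S"
  using assms
proof (induction "order S" arbitrary: S rule: less_induct)
  case less
  interpret group S by fact
  show ?case
  proof (cases "carrier S = {\<one>\<^bsub>S\<^esub>}")
    case True
    then have "lower_central_series S 0 = {\<one>\<^bsub>S\<^esub>}" by simp
    then show ?thesis unfolding nilpotent_group_def using is_group by blast
  next
    case False
    obtain z where z: "z \<in> carrier S" "z \<noteq> \<one>\<^bsub>S\<^esub>" and zc: "\<And>g. g \<in> carrier S \<Longrightarrow> g \<otimes>\<^bsub>S\<^esub> z = z \<otimes>\<^bsub>S\<^esub> g"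
      using coprime_commute_center[OF less.prems(2) conj_dense_imp_coprime_commute[OF less.prems(2,3)] False] by blast
    have Z: "generate S {z} \<lhd> S"
      "\<And>w g. w \<in> generate S {z} \<Longrightarrow> g \<in> carrier S \<Longrightarrow> g \<otimes>\<^bsub>S\<^esub> w = w \<otimes>\<^bsub>S\<^esub> g"
      by (rule central_generate_normal[OF less.prems(2) z(1)]; use zc in simp)+
    have ne: "generate S {z} \<noteq> {\<one>\<^bsub>S\<^esub>}" using z(2) generate_sing_self[of z] by blast
    obtain T :: "nat monoid" and f where f: "group_hom S T f" and
      T: "f ` carrier S = carrier T" "kernel S T f = generate S {z}" "finite (carrier T)" "order T < order S"
      using exists_smaller_nat_quotient[OF less.prems(2) Z(1) ne] .
    interpret f: group_hom S T f by fact
    have "nilpotent_group T"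
      using less.hyps[OF T(4)] f.H.is_group T(3) f.conj_dense_image[OF less.prems(3) T(1)] by blast
    then show ?thesis
      by (rule f.nilpotent_central_extension) (use Z(2) T(2) in simp)
  qed
qed

lemma (in group) conj_dense_imp_nilpotent:
  assumes fin: "finite (carrier G)" and d: "conj_dense G"
  shows "nilpotent_group G"
proof -
  obtain S :: "nat monoid" and f where S: "group S" "f \<in> epi G S" "kernel G S f = {\<one>}"
    using exists_nat_quotient[OF fin one_is_normal] .
  interpret f: group_hom G S f using S by (intro epi_group_hom) auto
  have onto: "f ` carrier G = carrier S" using S(2) by (simp add: epi_def)
  have "finite (carrier S)" using fin by (metis onto finite_imageI)
  then have "nilpotent_group S"
    using conj_dense_imp_nilpotent_nat S(1) f.conj_dense_image[OF d onto] by blast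
  then show ?thesis using f.nilpotent_central_extension S(3) by simp
qed

text \<open>\<open>G\<lparr>carrier := H\<rparr>\<close> keeps the extra record fields of
  \<open>G\<close>, whereas the factors of the product have to be of type
  \<open>'a monoid\<close>.\<close>

definition restrict_group :: "('a, 'b) monoid_scheme \<Rightarrow> 'a set \<Rightarrow> 'a monoid" where
  "restrict_group G H = \<lparr>carrier = H, monoid.mult = (\<otimes>\<^bsub>G\<^esub>), one = \<one>\<^bsub>G\<^esub>\<rparr>"

lemma restrict_group_simps [simp]:
  "carrier (restrict_group G H) = H" "monoid.mult (restrict_group G H) = (\<otimes>\<^bsub>G\<^esub>)"
  "\<one>\<^bsub>restrict_group G H\<^esub> = \<one>\<^bsub>G\<^esub>"
  by (simp_all add: restrict_group_def)

lemma (in group) restrict_group_is_group: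
  assumes "subgroup H G"
  shows "group (restrict_group G H)"
proof (rule groupI)
  interpret subgroup H G by fact
  fix x assume "x \<in> carrier (restrict_group G H)"
  then show "\<exists>y\<in>carrier (restrict_group G H). y \<otimes>\<^bsub>restrict_group G H\<^esub> x = \<one>\<^bsub>restrict_group G H\<^esub>"
    by (intro bexI[of _ "inv x"]) auto
qed (use assms in \<open>auto simp: subgroup.m_closed subgroup.one_closed subgroup.mem_carrier m_assoc\<close>)

text \<open>Normal subgroups with trivial intersection commute elementwise, which makes the map
  multiplicative; factorizations h k are unique, which makes it injective. The restriction is there
  because members of a product are extensional functions.\<close>

lemma (in group) product_group_extend:
  assumes H: "H \<lhd> G" and K: "K \<lhd> G" and HK: "H \<inter> K = {\<one>}"
    and P: "\<And>i. i < n \<Longrightarrow> group (P i)"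
    and \<theta>: "\<theta> \<in> iso (product_group {..<n} P) (G\<lparr>carrier := H\<rparr>)"
  shows "(\<lambda>f. \<theta> (restrict f {..<n}) \<otimes> f n) \<in>
    iso (product_group {..<Suc n} (P(n := restrict_group G K))) (G\<lparr>carrier := H <#> K\<rparr>)"
proof -
  let ?A = "product_group {..<n} P"
  let ?B = "product_group {..<Suc n} (P(n := restrict_group G K))"
  let ?\<psi> = "\<lambda>f. \<theta> (restrict f {..<n}) \<otimes> f n"
  interpret H: normal H G by fact
  interpret K: normal K G by fact
  have \<theta>h: "\<theta> \<in> hom ?A (G\<lparr>carrier := H\<rparr>)" and \<theta>b: "bij_betw \<theta> (carrier ?A) H"
    using \<theta> by (auto simp: iso_def)
  have comp: "restrict f {..<n} \<in> carrier ?A" "f n \<in> K" "f \<in> extensional {..<Suc n}" if "f \<in> carrier ?B" for f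
  proof -
    have fi: "f i \<in> carrier ((P(n := restrict_group G K)) i)" if "i < Suc n" for i
      using PiE_mem[OF \<open>f \<in> carrier ?B\<close>[unfolded carrier_product_group], of i] that by simp
    have "f i \<in> carrier (P i)" if "i < n" for i
      using fi[of i] that by (simp add: less_Suc_eq)
    then show "restrict f {..<n} \<in> carrier ?A" by simp
    show "f n \<in> K" using fi[of n] by simp
    show "f \<in> extensional {..<Suc n}" using that by (simp add: PiE_iff)
  qed
  have \<theta>H: "\<theta> (restrict f {..<n}) \<in> H" if "f \<in> carrier ?B" for f
    using comp(1)[OF that] \<theta>b bij_betwE by blast
  have mult: "?\<psi> (f \<otimes>\<^bsub>?B\<^esub> g) = ?\<psi> f \<otimes> ?\<psi> g" if f: "f \<in> carrier ?B" and g: "g \<in> carrier ?B" for f g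
  proof -
    have "restrict (f \<otimes>\<^bsub>?B\<^esub> g) {..<n} = restrict f {..<n} \<otimes>\<^bsub>?A\<^esub> restrict g {..<n}"
      by (auto simp: fun_eq_iff restrict_def)
    then have "\<theta> (restrict (f \<otimes>\<^bsub>?B\<^esub> g) {..<n}) = \<theta> (restrict f {..<n}) \<otimes> \<theta> (restrict g {..<n})"
      using hom_mult[OF \<theta>h comp(1)[OF f] comp(1)[OF g]] by simp
    moreover have "(f \<otimes>\<^bsub>?B\<^esub> g) n = f n \<otimes> g n" by simp
    moreover have "\<theta> (restrict g {..<n}) \<otimes> f n = f n \<otimes> \<theta> (restrict g {..<n})"
      using normal_imp_commuting[OF H K] HK \<theta>H[OF g] comp(2)[OF f] by simp
    moreover have "\<theta> (restrict f {..<n}) \<in> carrier G" "\<theta> (restrict g {..<n}) \<in> carrier G"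
      "f n \<in> carrier G" "g n \<in> carrier G"
      using \<theta>H f g comp(2) H.mem_carrier K.mem_carrier by blast+
    ultimately show ?thesis by (simp add: m_assoc) (simp add: m_assoc[symmetric])
  qed
  have inj: "inj_on ?\<psi> (carrier ?B)"
  proof (rule inj_onI)
    fix f g assume f: "f \<in> carrier ?B" and g: "g \<in> carrier ?B" and eq: "?\<psi> f = ?\<psi> g"
    interpret group_disjoint_sum G H K
      by (simp add: group_disjoint_sum_def H.subgroup_axioms K.subgroup_axioms is_group)
    have "\<theta> (restrict f {..<n}) = \<theta> (restrict g {..<n}) \<and> f n = g n"
      using cancel HK eq \<theta>H[OF f] \<theta>H[OF g] comp(2)[OF f] comp(2)[OF g] by blast
    then have "restrict f {..<n} = restrict g {..<n}" "f n = g n"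
      using \<theta>b comp(1)[OF f] comp(1)[OF g] unfolding bij_betw_def inj_on_def by blast+
    then have "f i = g i" if "i < Suc n" for i
      using that by (metis lessThan_iff less_antisym restrict_apply')
    then show "f = g" using comp(3)[OF f] comp(3)[OF g] by (auto intro: extensionalityI)
  qed
  have onto: "?\<psi> ` carrier ?B = H <#> K"
  proof (intro equalityI subsetI)
    fix x assume "x \<in> H <#> K"
    then obtain h k where hk: "h \<in> H" "k \<in> K" "x = h \<otimes> k" by (auto simp: mem_set_mult)
    obtain f where f: "f \<in> carrier ?A" "\<theta> f = h" using \<theta>b hk(1) unfolding bij_betw_def by blast
    have "f(n := k) \<in> carrier ?B"
      using f(1) hk(2) by (auto simp: PiE_iff extensional_def less_Suc_eq)
    moreover have "restrict (f(n := k)) {..<n} = f"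
      using f(1) by (auto simp: fun_eq_iff PiE_iff extensional_def restrict_def)
    then have "?\<psi> (f(n := k)) = x" using f hk by simp
    ultimately show "x \<in> ?\<psi> ` carrier ?B" by (metis (mono_tags, lifting) image_eqI)
  qed (use \<theta>H comp(2) in \<open>auto simp: mem_set_mult simp del: carrier_product_group\<close>)
  show ?thesis
    using inj onto mult by (auto simp: iso_def hom_def bij_betw_def simp del: carrier_product_group mult_product_group)
qed

text \<open>One prime is added at a time: its normal Sylow subgroup has order coprime to the product
  \<open>H\<close> built so far, hence meets it trivially and extends the direct product. Tracking
  |H| shows later that all prime factors together exhaust the group.\<close>

lemma (in group) sylow_product:
  assumes fin: "finite (carrier G)" and cc: "coprime_commute G"
    and "finite \<pi>" "\<And>p. p \<in> \<pi> \<Longrightarrow> Factorial_Ring.prime p"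
  shows "\<exists>H n P \<theta>. H \<lhd> G \<and> card H = (\<Prod>p\<in>\<pi>. p ^ multiplicity p (order G)) \<and>
    (\<forall>i<n. \<exists>p K. Factorial_Ring.prime p \<and> subgroup K G \<and> card K = p ^ multiplicity p (order G) \<and>
       P i = restrict_group G K) \<and>
    \<theta> \<in> iso (product_group {..<n::nat} P) (G\<lparr>carrier := H\<rparr>)"
  using assms(3,4)
proof (induction \<pi>)
  case empty
  have "(\<lambda>_. \<one>) \<in> iso (product_group {..<0::nat} (\<lambda>_. restrict_group G {})) (G\<lparr>carrier := {\<one>}\<rparr>)"
    by (auto simp: iso_def hom_def bij_betw_def)
  then show ?case using one_is_normal by (intro exI[of _ "{\<one>}"] exI[of _ 0]) auto
next
  case (insert p \<pi>)
  have p: "Factorial_Ring.prime p" using insert.prems by simp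
  obtain H n P \<theta> where H: "H \<lhd> G" and cardH: "card H = (\<Prod>p\<in>\<pi>. p ^ multiplicity p (order G))"
    and P: "\<And>i. i < (n::nat) \<Longrightarrow> \<exists>p K. Factorial_Ring.prime p \<and> subgroup K G \<and>
       card K = p ^ multiplicity p (order G) \<and> P i = restrict_group G K"
    and \<theta>: "\<theta> \<in> iso (product_group {..<n} P) (G\<lparr>carrier := H\<rparr>)"
    using insert.IH insert.prems by auto
  obtain K where K: "K \<lhd> G" "card K = p ^ multiplicity p (order G)"
    using exists_normal_sylow[OF fin cc p] .
  have sH: "subgroup H G" and sK: "subgroup K G" using H K(1) normal_imp_subgroup by auto
  have "coprime q p" if "q \<in> \<pi>" for q
    using that insert.prems insert.hyps p by (metis insert_iff primes_coprime)
  then have "coprime (card H) (card K)" unfolding cardH K(2) by (intro prod_coprime_left) auto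
  then have HK: "H \<inter> K = {\<one>}" using subgroup_coprime_Int[OF sH sK] by blast
  let ?P = "P(n := restrict_group G K)"
  have grp: "group (P i)" if "i < n" for i using P[OF that] restrict_group_is_group by auto
  have "(\<lambda>f. \<theta> (restrict f {..<n}) \<otimes> f n) \<in> iso (product_group {..<Suc n} ?P) (G\<lparr>carrier := H <#> K\<rparr>)"
    using product_group_extend[OF H K(1) HK grp \<theta>] .
  moreover have "H <#> K \<lhd> G" using normal_subgroup_set_mult_closed[OF H K(1)] .
  moreover have "card (H <#> K) = (\<Prod>p\<in>insert p \<pi>. p ^ multiplicity p (order G))"
    using card_set_mult_disjoint[OF sH sK HK] insert.hyps cardH K(2) by simp
  moreover have "\<exists>p K. Factorial_Ring.prime p \<and> subgroup K G \<and> card K = p ^ multiplicity p (order G) \<and>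
       ?P i = restrict_group G K" if "i < Suc n" for i
    using that P p K(2) sK by (cases "i = n") (auto simp: less_Suc_eq)
  ultimately show ?case by blast
qed

lemma (in group) iso_product_sylow:
  assumes fin: "finite (carrier G)" and cc: "coprime_commute G"
  shows "\<exists>n P. (\<forall>i<n. \<exists>p K. Factorial_Ring.prime p \<and> subgroup K G \<and> card K = p ^ multiplicity p (order G) \<and>
       P i = restrict_group G K) \<and> G \<cong> product_group {..<n::nat} P"
proof -
  obtain H n P \<theta> where H: "H \<lhd> G" and cardH: "card H = (\<Prod>p\<in>prime_factors (order G). p ^ multiplicity p (order G))"
    and P: "\<forall>i<(n::nat). \<exists>p K. Factorial_Ring.prime p \<and> subgroup K G \<and>
       card K = p ^ multiplicity p (order G) \<and> P i = restrict_group G K"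
    and \<theta>: "\<theta> \<in> iso (product_group {..<n} P) (G\<lparr>carrier := H\<rparr>)"
    using sylow_product[OF fin cc finite_set_mset[of "prime_factorization (order G)"]] in_prime_factors_imp_prime[of _ "order G"] by blast
  have "order G \<noteq> 0" using fin order_gt_0_iff_finite by simp
  then have "card H = card (carrier G)" using cardH prime_factorization_nat[of "order G"] by (simp add: order_def)
  then have "H = carrier G"
    using fin subgroup.subset[OF normal_imp_subgroup[OF H]] by (intro card_subset_eq)
  then have "product_group {..<n} P \<cong> G" using \<theta> by (simp add: is_isoI)
  moreover have "group (product_group {..<n} P)"
    using P restrict_group_is_group by (intro product_group) auto
  ultimately have "G \<cong> product_group {..<n} P" by (simp add: group.iso_sym)
  then show ?thesis using P by blast
qed

subsection \<open>Permuting cyclic subgroups\<close>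

context group begin

lemma set_mult_comm_if_subgroup:
  assumes H: "subgroup H G" and K: "subgroup K G" and HK: "subgroup (H <#> K) G"
  shows "H <#> K = K <#> H"
proof (intro equalityI subsetI)
  fix x assume "x \<in> H <#> K"
  then have "inv x \<in> H <#> K" and xc: "x \<in> carrier G"
    using subgroup.m_inv_closed[OF HK] subgroup.mem_carrier[OF HK] by auto
  then obtain h k where hk: "h \<in> H" "k \<in> K" "inv x = h \<otimes> k" by (auto simp: mem_set_mult)
  have c: "h \<in> carrier G" "k \<in> carrier G" using hk H K subgroup.mem_carrier by metis+
  have "x = inv (inv x)" using xc by simp
  also have "\<dots> = inv k \<otimes> inv h" unfolding hk(3) using c by (rule inv_mult_group)
  finally have "x = inv k \<otimes> inv h" .
  moreover have "inv k \<in> K" "inv h \<in> H" using hk H K by (auto intro: subgroup.m_inv_closed)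
  ultimately show "x \<in> K <#> H" unfolding mem_set_mult by blast
next
  fix x assume "x \<in> K <#> H"
  then obtain h k where hk: "h \<in> H" "k \<in> K" "x = k \<otimes> h" by (auto simp: mem_set_mult)
  then show "x \<in> H <#> K"
    using subset_set_mult[OF H K] subgroup.m_closed[OF HK] by blast
qed

lemma subgroup_set_mult_if_comm:
  assumes H: "subgroup H G" and K: "subgroup K G" and comm: "H <#> K = K <#> H"
  shows "subgroup (H <#> K) G"
proof (rule subgroupI)
  interpret H: subgroup H G by fact
  interpret K: subgroup K G by fact
  show "H <#> K \<subseteq> carrier G" using H.subset K.subset by (rule setmult_subset_G)
  show "H <#> K \<noteq> {}" using subset_set_mult[OF H K] H.one_closed by blast
  show "inv a \<in> H <#> K" if "a \<in> H <#> K" for a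
  proof -
    obtain h k where "h \<in> H" "k \<in> K" "a = h \<otimes> k" using \<open>a \<in> H <#> K\<close> by (auto simp: mem_set_mult)
    then have "inv a = inv k \<otimes> inv h" "inv k \<in> K" "inv h \<in> H" by (simp_all add: inv_mult_group)
    then show ?thesis unfolding comm by (auto simp: mem_set_mult)
  qed
  show "a \<otimes> b \<in> H <#> K" if "a \<in> H <#> K" "b \<in> H <#> K" for a b
  proof -
    obtain h k where 1: "h \<in> H" "k \<in> K" "a = h \<otimes> k" using \<open>a \<in> H <#> K\<close> by (auto simp: mem_set_mult)
    obtain h' k' where 2: "h' \<in> H" "k' \<in> K" "b = h' \<otimes> k'" using \<open>b \<in> H <#> K\<close> by (auto simp: mem_set_mult)
    have "k \<otimes> h' \<in> H <#> K" using 1 2 unfolding comm by (auto simp: mem_set_mult)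
    then obtain h'' k'' where 3: "h'' \<in> H" "k'' \<in> K" "k \<otimes> h' = h'' \<otimes> k''" by (auto simp: mem_set_mult)
    have "a \<otimes> b = h \<otimes> (k \<otimes> h') \<otimes> k'" using 1 2 by (simp add: m_assoc)
    also have "\<dots> = (h \<otimes> h'') \<otimes> (k'' \<otimes> k')" using 1 2 3 by (simp add: m_assoc)
    finally show ?thesis using 1 2 3 by (auto simp: mem_set_mult)
  qed
qed

lemma generate_eq_prime_card:
  assumes H: "subgroup H G" "card H = p" "Factorial_Ring.prime p" and w: "w \<in> H" "w \<noteq> \<one>"
  shows "generate G {w} = H"
proof -
  have wc: "w \<in> carrier G" using H(1) w(1) by (rule subgroup.mem_carrier)
  have "ord w dvd p" using ord_dvd_card_subgroup[OF H(1) w(1)] H(2) by simp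
  then have "ord w = p" using H(3) w(2) ord_eq_1[OF wc] by (metis prime_nat_iff)
  moreover have "finite H" using H by (metis card.infinite not_prime_0)
  ultimately show ?thesis
    using generate_pow_card[OF wc] generate_subgroup_incl[OF _ H(1), of "{w}"] w(1) H(2)
    by (intro card_subset_eq) auto
qed

text \<open>A nontrivial power of an element of prime order generates the same subgroup, so x is a
  power of that power.\<close>

lemma commute_if_power_commutes:
  assumes fin: "finite (carrier G)" and p: "Factorial_Ring.prime p"
    and x: "x \<in> carrier G" "ord x = p" and y: "y \<in> carrier G"
    and i: "x [^] (i::nat) \<noteq> \<one>" "x [^] i \<otimes> y = y \<otimes> x [^] i"
  shows "x \<otimes> y = y \<otimes> x"
proof -
  have "x \<in> generate G {x [^] i}"
    using generate_eq_prime_card[OF cyclic_subgroup[OF x(1)] _ p pow_mem_generate[OF x(1)] i(1)]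
      generate_pow_card[OF x(1)] x(2) generate_sing_self[of x] by simp
  then obtain k where "x = (x [^] i) [^] (k::nat)"
    using generate_singE[OF fin nat_pow_closed[OF x(1)]] by blast
  then show ?thesis using pow_comm[OF nat_pow_closed[OF x(1)] y i(2), of k] by simp
qed

text \<open>Permutability of the two cyclic subgroups, that is, their product is a subgroup. Cyclic
  subgroups suffice, because products of arbitrary subgroups are tested element by element.\<close>

definition permute :: "'a \<Rightarrow> 'a \<Rightarrow> bool" where
  "permute x y \<longleftrightarrow> generate G {x} <#> generate G {y} = generate G {y} <#> generate G {x}"

lemma commute_imp_permute:
  assumes "finite (carrier G)" "x \<in> carrier G" "y \<in> carrier G" "x \<otimes> y = y \<otimes> x"
  shows "permute x y"
proof -
  have "a \<otimes> b = b \<otimes> a" if ab: "a \<in> generate G {x}" "b \<in> generate G {y}" for a b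
  proof -
    obtain i where i: "a = x [^] (i::nat)" by (rule generate_singE[OF assms(1,2) ab(1)])
    obtain j where j: "b = y [^] (j::nat)" by (rule generate_singE[OF assms(1,3) ab(2)])
    have "x [^] i \<otimes> y = y \<otimes> x [^] i" using pow_comm[OF assms(2-4)] .
    from pow_comm[OF assms(3) nat_pow_closed[OF assms(2)] this[symmetric], of j]
    show ?thesis by (simp add: i j)
  qed
  then show ?thesis unfolding permute_def set_mult_def by force
qed

text \<open>The product of the two subgroups is a p-group and has a nontrivial central element a b.
  If a is not 1, then y commutes with a b and with b, hence with a, which generates
  \<langle>x\<rangle>; otherwise x commutes with b, which generates \<langle>y\<rangle>.\<close>

lemma permute_prime_order_commute:
  assumes p: "Factorial_Ring.prime p" and ord: "order G = p ^ n"
    and x: "x \<in> carrier G" "ord x = p" and y: "y \<in> carrier G" "ord y = p"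
    and perm: "permute x y"
  shows "x \<otimes> y = y \<otimes> x"
proof -
  have fin: "finite (carrier G)" using ord p by (metis order_gt_0_iff_finite prime_gt_0_nat zero_less_power)
  let ?H = "generate G {x} <#> generate G {y}"
  note X = cyclic_subgroup[OF x(1)] and Y = cyclic_subgroup[OF y(1)]
  have H: "subgroup ?H G" using subgroup_set_mult_if_comm[OF X Y] perm by (simp add: permute_def)
  interpret H: group "G\<lparr>carrier := ?H\<rparr>" using H by (rule subgroup_imp_group)
  have xH: "x \<in> ?H" "y \<in> ?H" using subset_set_mult[OF X Y] generate_sing_self by blast+
  have "x \<noteq> \<one>" using x p by auto
  then have "?H \<noteq> {\<one>}" using xH by blast
  moreover obtain k where "card ?H = p ^ k"
    using card_subgroup_dvd[OF H] ord divides_primepow_nat[OF p] by auto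
  ultimately have "\<exists>z\<in>?H. z \<noteq> \<one> \<and> (\<forall>g\<in>?H. g \<otimes> z = z \<otimes> g)"
    using H.p_group_center[OF p _ H.normal_self, of k] by (simp add: order_def)
  then obtain z where z: "z \<in> ?H" "z \<noteq> \<one>" "\<And>g. g \<in> ?H \<Longrightarrow> g \<otimes> z = z \<otimes> g" by blast
  obtain a b where ab: "a \<in> generate G {x}" "b \<in> generate G {y}" "z = a \<otimes> b"
    using z(1) by (auto simp: mem_set_mult)
  obtain i where i: "a = x [^] (i::nat)" by (rule generate_singE[OF fin x(1) ab(1)])
  obtain j where j: "b = y [^] (j::nat)" by (rule generate_singE[OF fin y(1) ab(2)])
  have ac: "a \<in> carrier G" "b \<in> carrier G" using i j x y by auto
  show ?thesis
  proof (cases "a = \<one>")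
    case False
    have "y \<otimes> (a \<otimes> b) = (a \<otimes> b) \<otimes> y" using z(3)[OF xH(2)] ab(3) by simp
    moreover have "b \<otimes> y = y \<otimes> b" using y(1) unfolding j by (metis nat_pow_Suc nat_pow_Suc2)
    ultimately have "(y \<otimes> a) \<otimes> b = (a \<otimes> y) \<otimes> b" using ac y(1) by (simp add: m_assoc)
    then have "a \<otimes> y = y \<otimes> a" using ac y(1) by simp
    then show ?thesis using commute_if_power_commutes[OF fin p x y(1), of i] False i by simp
  next
    case True
    then have "b \<noteq> \<one>" "z = b" using z(2) ab(3) ac by auto
    then have "b \<otimes> x = x \<otimes> b" using z(3)[OF xH(1)] by simp
    then show ?thesis using commute_if_power_commutes[OF fin p y x(1), of j] \<open>b \<noteq> \<one>\<close> j by simp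
  qed
qed

text \<open>Sorting the factors of (g h)^n creates one central c for each pair of positions where a
  g passes an earlier h, hence the binomial coefficient. It is needed with n = p odd, where the
  c-part vanishes if c^p = 1.\<close>

lemma mult_pow_class_two:
  assumes g: "g \<in> carrier G" and h: "h \<in> carrier G" and c: "c \<in> carrier G"
    and hg: "h \<otimes> g = g \<otimes> h \<otimes> c" and cg: "c \<otimes> g = g \<otimes> c" and ch: "c \<otimes> h = h \<otimes> c"
  shows "(g \<otimes> h) [^] (n::nat) = g [^] n \<otimes> h [^] n \<otimes> c [^] (n choose 2)"
proof (induction n)
  case (Suc n)
  have 1: "h [^] n \<otimes> g = g \<otimes> h [^] n \<otimes> c [^] n" for n :: nat
  proof (induction n)
    case (Suc n)
    have "h [^] Suc n \<otimes> g = h [^] n \<otimes> (g \<otimes> h \<otimes> c)" using g h c by (simp add: m_assoc hg)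
    also have "\<dots> = (h [^] n \<otimes> g) \<otimes> (h \<otimes> c)" using g h c by (simp add: m_assoc)
    also have "\<dots> = g \<otimes> h [^] n \<otimes> (c [^] n \<otimes> h) \<otimes> c" using g h c by (simp add: Suc m_assoc)
    also have "c [^] n \<otimes> h = h \<otimes> c [^] n" using pow_comm[OF c h ch] .
    finally show ?case using g h c by (simp add: m_assoc)
  qed (use g h c in simp)
  let ?k = "n choose 2"
  have "(g \<otimes> h) [^] Suc n = g [^] n \<otimes> h [^] n \<otimes> (c [^] ?k \<otimes> g) \<otimes> h" using g h c by (simp add: Suc m_assoc)
  also have "c [^] ?k \<otimes> g = g \<otimes> c [^] ?k" using pow_comm[OF c g cg] .
  also have "g [^] n \<otimes> h [^] n \<otimes> (g \<otimes> c [^] ?k) \<otimes> h = g [^] n \<otimes> (h [^] n \<otimes> g) \<otimes> (c [^] ?k \<otimes> h)"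
    using g h c by (simp add: m_assoc)
  also have "\<dots> = g [^] n \<otimes> g \<otimes> h [^] n \<otimes> (c [^] n \<otimes> h) \<otimes> c [^] ?k"
    unfolding 1 pow_comm[OF c h ch, of ?k] using g h c by (simp add: m_assoc)
  also have "c [^] n \<otimes> h = h \<otimes> c [^] n" using pow_comm[OF c h ch] .
  also have "g [^] n \<otimes> g \<otimes> h [^] n \<otimes> (h \<otimes> c [^] n) \<otimes> c [^] ?k = g [^] Suc n \<otimes> h [^] Suc n \<otimes> c [^] (n + ?k)"
    using g h c by (simp add: m_assoc nat_pow_mult[symmetric])
  also have "n + ?k = Suc n choose 2" by (simp add: numeral_2_eq_2)
  finally show ?case .
qed (use g h c in \<open>simp add: numeral_2_eq_2\<close>)

lemma subgroup_normal_if_commutators: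
  assumes H: "subgroup H G" and comm: "\<And>g h. g \<in> carrier G \<Longrightarrow> h \<in> H \<Longrightarrow> g \<otimes> h \<otimes> inv g \<otimes> inv h \<in> H"
  shows "H \<lhd> G"
proof (rule normal_invI[OF H])
  fix g h assume g: "g \<in> carrier G" and h: "h \<in> H"
  have hc: "h \<in> carrier G" using H h by (rule subgroup.mem_carrier)
  have "g \<otimes> h \<otimes> inv g = (g \<otimes> h \<otimes> inv g \<otimes> inv h) \<otimes> h" using g hc by (simp add: m_assoc)
  then show "g \<otimes> h \<otimes> inv g \<in> H" using comm[OF g h] h subgroup.m_closed[OF H] by metis
qed

text \<open>A cyclic group has only one subgroup of order p, and every element killed by p lies in
  it.\<close>

lemma mem_generate_pow_if_ord_dvd:
  assumes fin: "finite (carrier G)" and x: "x \<in> carrier G" and p: "p dvd ord x" "p > 0"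
    and w: "w \<in> generate G {x}" "w [^] p = \<one>"
  shows "w \<in> generate G {x [^] (ord x div p)}"
proof -
  obtain j where j: "w = x [^] (j::nat)" by (rule generate_singE[OF fin x w(1)])
  have "ord x dvd j * p" using w(2) x by (simp add: j nat_pow_pow pow_eq_id)
  moreover obtain t where t: "ord x = p * t" using p(1) by blast
  ultimately have "ord x div p dvd j" using p(2) by (simp add: mult.commute)
  then obtain l where "j = ord x div p * l" by blast
  then have "w = (x [^] (ord x div p)) [^] l" using x by (simp add: j nat_pow_pow)
  then show ?thesis using pow_mem_generate[OF nat_pow_closed[OF x]] by simp
qed

end

section \<open>Reduction of a minimal non-permuting pair to elements of order p\<close>

context group begin

text \<open>On a finite set conjugation is injective, so mapping the set into itself already means
  mapping it onto itself.\<close>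

lemma normalizer_memI:
  assumes fin: "finite A" and A: "A \<subseteq> carrier G" and g: "g \<in> carrier G"
    and conj: "\<And>h. h \<in> A \<Longrightarrow> g \<otimes> h \<otimes> inv g \<in> A"
  shows "g \<in> normalizer G A"
proof -
  have "inj_on (\<lambda>h. g \<otimes> h \<otimes> inv g) A"
    using A g by (intro inj_onI) (metis conjugation_is_inj subsetD)
  then have "(\<lambda>h. g \<otimes> h \<otimes> inv g) ` A = A" using fin conj by (intro endo_inj_surj) auto
  then show ?thesis using A g by (simp add: normalizer_def stabilizer_def conj_set_eq)
qed

lemma conj_mem_set_mult_generate:
  assumes fin: "finite (carrier G)" and a: "a \<in> carrier G" and b: "b \<in> carrier G" and g: "g \<in> carrier G"
    and A: "subgroup A G" "A = generate G {a} <#> generate G {b}"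
    and conj: "g \<otimes> a \<otimes> inv g \<in> A" "g \<otimes> b \<otimes> inv g \<in> A"
    and h: "h \<in> A"
  shows "g \<otimes> h \<otimes> inv g \<in> A"
proof -
  obtain s t where st: "s \<in> generate G {a}" "t \<in> generate G {b}" "h = s \<otimes> t"
    using h A(2) by (auto simp: mem_set_mult)
  obtain i where i: "s = a [^] (i::nat)" by (rule generate_singE[OF fin a st(1)])
  obtain j where j: "t = b [^] (j::nat)" by (rule generate_singE[OF fin b st(2)])
  have "(g \<otimes> a [^] i \<otimes> inv g) \<otimes> (g \<otimes> b [^] j \<otimes> inv g) = g \<otimes> a [^] i \<otimes> (inv g \<otimes> g) \<otimes> b [^] j \<otimes> inv g"
    using a b g by (simp only: m_assoc m_closed inv_closed nat_pow_closed)
  also have "\<dots> = g \<otimes> h \<otimes> inv g" using a b g by (simp add: st(3) i j m_assoc)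
  finally have "g \<otimes> h \<otimes> inv g = (g \<otimes> a \<otimes> inv g) [^] i \<otimes> (g \<otimes> b \<otimes> inv g) [^] j"
    using a b g by (simp only: pow_conj)
  moreover have "w [^] k \<in> A" if "w \<in> A" for w and k :: nat
    using pow_mem_generate[of w k] generate_subgroup_incl[OF _ A(1), of "{w}"] that subgroup.mem_carrier[OF A(1)]
    by blast
  ultimately show ?thesis using conj subgroup.m_closed[OF A(1)] by simp
qed

text \<open>The hypotheses describe a pair of non-permuting cyclic subgroups with minimal product of
  orders in a minimal \<open>p\<close>-group containing such a pair.\<close>

lemma minimal_nonpermuting_orders:
  assumes p: "Factorial_Ring.prime p" and ord: "order G = p ^ n"
    and xy: "x \<in> carrier G" "y \<in> carrier G" "\<not> permute x y"
    and min: "\<And>a b. a \<in> carrier G \<Longrightarrow> b \<in> carrier G \<Longrightarrow> ord a * ord b < ord x * ord y \<Longrightarrow> permute a b"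
    and gen: "\<And>W. subgroup W G \<Longrightarrow> x \<in> W \<Longrightarrow> y \<in> W \<Longrightarrow> W = carrier G"
    and nc: "\<And>K. K \<lhd> G \<Longrightarrow> K \<noteq> {\<one>} \<Longrightarrow> \<not> K \<subseteq> generate G {x} <#> generate G {y}"
  shows "ord x = p" "ord y = p"
proof -
  have fin: "finite (carrier G)" using ord p by (metis order_gt_0_iff_finite prime_gt_0_nat zero_less_power)
  have pp: "p > 1" using p by (rule prime_gt_1_nat)
  \<comment> \<open>A generator of the subgroup of order p of \<langle>a\<rangle>.\<close>
  define root where "root a = a [^] (ord a div p)" for a
  have nontriv: "a \<noteq> \<one>" if "a \<in> {x, y}" for a
    using commute_imp_permute[OF fin xy(1,2)] xy that by auto
  have pord: "p dvd ord a" "ord a \<noteq> p \<Longrightarrow> p < ord a" if a: "a \<in> {x, y}" for a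
  proof -
    have ac: "a \<in> carrier G" using a xy by auto
    have "ord a \<noteq> 1" using nontriv[OF a] ord_eq_1[OF ac] by simp
    moreover obtain k where k: "ord a = p ^ k"
      using ord_dvd_group_order[OF ac] ord divides_primepow_nat[OF p] by auto
    ultimately show 1: "p dvd ord a" by (cases k) auto
    have "ord a > 0" using k pp by simp
    then show "ord a \<noteq> p \<Longrightarrow> p < ord a" using dvd_imp_le[OF 1] by simp
  qed
  have root: "root a \<in> carrier G" "ord (root a) = p" "root a \<in> generate G {a}" if a: "a \<in> {x, y}" for a
  proof -
    have ac: "a \<in> carrier G" using a xy by auto
    show "root a \<in> carrier G" "root a \<in> generate G {a}"
      using ac pow_mem_generate[OF ac] by (simp_all add: root_def)
    obtain t where t: "ord a = p * t" using pord(1)[OF a] by blast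
    moreover have "ord a \<noteq> 0" using ord_ge_1[OF fin ac] by simp
    ultimately show "ord (root a) = p" unfolding root_def using ac pp by (subst ord_pow) auto
  qed
  \<comment> \<open>The assumptions are symmetric in x and y. The facts that follow are stated for
    the pair in either order, so each argument is given once.\<close>
  have symm: "permute a b" if "a \<in> carrier G" "b \<in> carrier G" "ord a * ord b < ord y * ord x" for a b
    using min that by (simp add: mult.commute)
  have gen': "W = carrier G" if "subgroup W G" "a \<in> W" "b \<in> W" "(a, b) = (x, y) \<or> (a, b) = (y, x)" for W a b
    using gen that by auto
  have min': "permute c d"
    if "(a, b) = (x, y) \<or> (a, b) = (y, x)" "c \<in> carrier G" "d \<in> carrier G" "ord c * ord d < ord a * ord b" for a b c d
    using min symm that by auto
  have sub: "generate G {a} \<subseteq> generate G {x} <#> generate G {y}" if "a \<in> {x, y}" for a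
    using subset_set_mult[OF cyclic_subgroup[OF xy(1)] cyclic_subgroup[OF xy(2)]] that by auto
  \<comment> \<open>If b had larger order, a and \<open>root b\<close> would permute by minimality
    and so commute. Then \<open>root b\<close> commutes with both generators and is central, so
    \<langle>root b\<rangle> is a nontrivial normal subgroup inside
    \<langle>x\<rangle>\<langle>y\<rangle>, which \<open>nc\<close> forbids.\<close>
  have one: "ord b = p" if ab: "(a, b) = (x, y) \<or> (a, b) = (y, x)" and a: "ord a = p" for a b
  proof (rule ccontr)
    assume "ord b \<noteq> p"
    have mem: "a \<in> {x, y}" "b \<in> {x, y}" "a \<in> carrier G" "b \<in> carrier G" using ab xy by auto
    have "p < ord b" using pord(2)[OF mem(2)] \<open>ord b \<noteq> p\<close> by simp
    then have "permute a (root b)" using root[OF mem(2)] mem a pp by (intro min'[OF ab]) auto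
    then have "a \<otimes> root b = root b \<otimes> a"
      using permute_prime_order_commute[OF p ord mem(3) a root(1,2)[OF mem(2)]] by simp
    moreover have "b \<otimes> root b = root b \<otimes> b"
      unfolding root_def using mem(4) by (metis nat_pow_Suc nat_pow_Suc2)
    ultimately have "{g \<in> carrier G. g \<otimes> root b = root b \<otimes> g} = carrier G"
      using mem by (intro gen'[OF centralizer_subgroup[OF root(1)[OF mem(2)]] _ _ ab]) auto
    then have "generate G {root b} \<lhd> G"
      using central_generate_normal(1)[OF fin root(1)[OF mem(2)]] by blast
    moreover have "root b \<noteq> \<one>" using root(2)[OF mem(2)] pp by auto
    then have "generate G {root b} \<noteq> {\<one>}" using generate_sing_self[of "root b"] by blast
    ultimately have "\<not> generate G {root b} \<subseteq> generate G {x} <#> generate G {y}" by (rule nc)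
    moreover have "generate G {root b} \<subseteq> generate G {b}"
      using root(3)[OF mem(2)] cyclic_subgroup[OF mem(4)] by (intro generate_subgroup_incl) auto
    ultimately show False using sub[OF mem(2)] by blast
  qed
  have "ord x = p \<or> ord y = p"
  proof (rule ccontr)
    assume "\<not> ?thesis"
    then have gt: "p < ord a" if "a \<in> {x, y}" for a using pord(2)[OF that] that by auto
    have pplt: "p * p < ord a * ord b" if "a \<in> {x, y}" "b \<in> {x, y}" for a b
      using gt[OF that(1)] gt[OF that(2)] by (intro mult_strict_mono) auto
    \<comment> \<open>If both orders exceed p, this product of the two subgroups of order p turns
      out to be normal. It lies in \<langle>x\<rangle>\<langle>y\<rangle>, contrary to
      \<open>nc\<close>.\<close>
    define A where "A = generate G {root x} <#> generate G {root y}"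
    have r: "root x \<in> carrier G" "root y \<in> carrier G" using root by auto
    have "permute (root x) (root y)" using root pplt by (intro min) auto
    then have comm: "A = generate G {root y} <#> generate G {root x}" by (simp add: A_def permute_def)
    then have A: "subgroup A G"
      using subgroup_set_mult_if_comm[OF cyclic_subgroup[OF r(1)] cyclic_subgroup[OF r(2)]] by (simp add: A_def)
    have rA: "root x \<in> A" "root y \<in> A"
      using subset_set_mult[OF cyclic_subgroup[OF r(1)] cyclic_subgroup[OF r(2)]] generate_sing_self
      unfolding A_def by blast+
    \<comment> \<open>Since \<langle>root a\<rangle> and \<langle>b\<rangle> permute by minimality,
      the conjugate is s t with s in the first and t in the second. It has order p, so it permutes
      and hence commutes with \<open>root a\<close>. Then s and t commute, t^p = 1, and t falls into
      \<langle>root b\<rangle>.\<close>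
    have conj: "b \<otimes> root a \<otimes> inv b \<in> generate G {root a} <#> generate G {root b}"
      if ab: "(a, b) = (x, y) \<or> (a, b) = (y, x)" for a b
    proof -
      have mem: "a \<in> {x, y}" "b \<in> {x, y}" "a \<in> carrier G" "b \<in> carrier G" using ab xy by auto
      define a0 where "a0 = root a"
      have a0: "a0 \<in> carrier G" "ord a0 = p" using root[OF mem(1)] by (simp_all add: a0_def)
      let ?W = "generate G {a0} <#> generate G {b}"
      note cyc = cyclic_subgroup[OF a0(1)] cyclic_subgroup[OF mem(4)]
      have "permute a0 b"
        using a0 mem gt[OF mem(1)] gt[OF mem(2)] by (intro min'[OF ab]) auto
      then have W: "subgroup ?W G" using subgroup_set_mult_if_comm[OF cyc] by (simp add: permute_def)
      have "a0 \<in> ?W" "b \<in> ?W" using subset_set_mult[OF cyc] generate_sing_self by blast+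
      then have "b \<otimes> a0 \<otimes> inv b \<in> ?W"
        using W by (intro subgroup.m_closed[OF W] subgroup.m_inv_closed[OF W])
      then obtain s t where st: "s \<in> generate G {a0}" "t \<in> generate G {b}" "b \<otimes> a0 \<otimes> inv b = s \<otimes> t"
        by (auto simp: mem_set_mult)
      define a' where "a' = b \<otimes> a0 \<otimes> inv b"
      have a': "a' \<in> carrier G" "ord a' = p" using a0 mem by (simp_all add: a'_def ord_conj)
      have "permute a0 a'" using a' a0 pplt[of a b] mem by (intro min'[OF ab]) auto
      then have "a0 \<otimes> a' = a' \<otimes> a0" using permute_prime_order_commute[OF p ord a0 a'] by simp
      moreover obtain i where i: "s = a0 [^] (i::nat)" by (rule generate_singE[OF fin a0(1) st(1)])
      ultimately have sa: "s \<otimes> a' = a' \<otimes> s" using pow_comm[OF a0(1) a'(1)] by simp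
      have sc: "s \<in> carrier G" and tc: "t \<in> carrier G"
        using subgroup.mem_carrier[OF cyc(1) st(1)] subgroup.mem_carrier[OF cyc(2) st(2)] by auto
      have a'st: "a' = s \<otimes> t" using st(3) by (simp add: a'_def)
      have "s \<otimes> (s \<otimes> t) = s \<otimes> (t \<otimes> s)" using sa sc tc by (simp add: a'st m_assoc)
      then have stc: "s \<otimes> t = t \<otimes> s" using sc tc by simp
      have "s [^] p = (a0 [^] p) [^] i" using a0(1) by (simp add: i nat_pow_pow mult.commute)
      also have "a0 [^] p = \<one>" using a0 by (metis pow_ord_eq_1)
      finally have "s [^] p = \<one>" by simp
      moreover have "a' [^] p = \<one>" using a' by (metis pow_ord_eq_1)
      ultimately have "t [^] p = \<one>"
        using pow_mult_distrib[OF stc sc tc, of p] sc tc by (simp add: a'st)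
      then have "t \<in> generate G {root b}"
        unfolding root_def using mem_generate_pow_if_ord_dvd[OF fin mem(4) pord(1)[OF mem(2)] _ st(2)] pp by simp
      then show ?thesis using st(1) a'st unfolding a'_def a0_def by (auto simp: mem_set_mult)
    qed
    have self: "a \<otimes> root a \<otimes> inv a = root a" if a: "a \<in> {x, y}" for a
    proof -
      have ac: "a \<in> carrier G" using a xy by auto
      have "a \<otimes> root a = root a \<otimes> a" unfolding root_def using ac by (metis nat_pow_Suc nat_pow_Suc2)
      then show ?thesis using ac root(1)[OF a] by (simp add: inv_solve_right')
    qed
    have AsubG: "A \<subseteq> carrier G" using A by (rule subgroup.subset)
    have finA: "finite A" using finite_subgroup[OF fin A] .
    have "g \<otimes> h \<otimes> inv g \<in> A" if g: "g \<in> {x, y}" and h: "h \<in> A" for g h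
    proof -
      have gc: "g \<in> carrier G" using g xy by auto
      have "g \<otimes> root x \<otimes> inv g \<in> A \<and> g \<otimes> root y \<otimes> inv g \<in> A"
        using g self[of x] self[of y] rA conj[of x y] conj[of y x] unfolding comm[symmetric] A_def[symmetric] by auto
      then show ?thesis using conj_mem_set_mult_generate[OF fin r gc A A_def _ _ h] by blast
    qed
    \<comment> \<open>The normalizer contains x and y, which generate the group.\<close>
    then have "normalizer G A = carrier G"
      using normalizer_memI[OF finA AsubG] xy by (intro gen normalizer_imp_subgroup AsubG) auto
    then have "(\<lambda>h. g \<otimes> h \<otimes> inv g) ` A = A" if "g \<in> carrier G" for g
      using that AsubG by (auto simp: normalizer_def stabilizer_def conj_set_eq)
    then have "A \<lhd> G" by (intro normal_invI[OF A]) (metis imageI)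
    moreover have "root x \<noteq> \<one>" using root(2)[of x] pp by auto
    then have "A \<noteq> {\<one>}" using rA by blast
    ultimately have "\<not> A \<subseteq> generate G {x} <#> generate G {y}" by (rule nc)
    moreover have "generate G {root a} \<subseteq> generate G {a}" if "a \<in> {x, y}" for a
      using root(3)[OF that] cyclic_subgroup[of a] that xy by (intro generate_subgroup_incl) auto
    ultimately show False unfolding A_def by (meson insertI1 insertI2 mono_set_mult)
  qed
  then show "ord x = p" "ord y = p" using one by auto
qed

end

section \<open>Noncommuting elements of order p with central commutators, p odd\<close>

context group begin

lemma set_mult_subset:
  assumes "subgroup E G" "A \<subseteq> E" "B \<subseteq> E"
  shows "A <#> B \<subseteq> E"
  using assms by (auto simp: mem_set_mult intro!: subgroup.m_closed)

text \<open>This is the configuration left after the reduction: \<open>full\<close> bounds the order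
  by p^3, \<open>central\<close> and \<open>abel\<close> give class at most two. The contradiction
  comes from counting normal subgroups.\<close>

lemma prime_order_pair_commutes:
  assumes p: "Factorial_Ring.prime p" "odd p" and ord: "order G = p ^ n" and d: "d_prime G > 2/3"
    and x: "x \<in> carrier G" "ord x = p" and y: "y \<in> carrier G" "ord y = p"
    and N: "N \<lhd> G" "card N = p" and full: "N <#> (generate G {x} <#> generate G {y}) = carrier G"
    and central: "\<And>w g. w \<in> N \<Longrightarrow> g \<in> carrier G \<Longrightarrow> g \<otimes> w = w \<otimes> g"
    and abel: "\<And>g h. g \<in> carrier G \<Longrightarrow> h \<in> carrier G \<Longrightarrow> g \<otimes> h \<otimes> inv g \<otimes> inv h \<in> N"
  shows "x \<otimes> y = y \<otimes> x"
proof (rule ccontr)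
  assume nc: "x \<otimes> y \<noteq> y \<otimes> x"
  have fin: "finite (carrier G)" using ord p by (metis order_gt_0_iff_finite prime_gt_0_nat zero_less_power)
  have pp: "p > 1" using p(1) by (rule prime_gt_1_nat)
  interpret N: normal N G by fact
  let ?X = "generate G {x}" and ?Y = "generate G {y}"
  have X: "subgroup ?X G" "card ?X = p" and Y: "subgroup ?Y G" "card ?Y = p"
    using cyclic_subgroup x y generate_pow_card by simp_all
  have fin': "finite N" "finite ?X" "finite ?Y"
    using finite_subgroup[OF fin] N.is_subgroup X Y by auto
  have "order G \<le> p * (p * p)"
  proof -
    have "finite (?X <#> ?Y)" using fin X Y by (meson finite_subset setmult_subset_G subgroup.subset)
    then have "order G \<le> card N * card (?X <#> ?Y)"
      using card_set_mult_le[OF fin'(1), of "?X <#> ?Y"] full by (simp add: order_def)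
    also have "\<dots> \<le> p * (p * p)"
      using card_set_mult_le[OF fin'(2,3)] N(2) X Y by (intro mult_mono) auto
    finally show ?thesis .
  qed
  then have le3: "order G \<le> p ^ 3" by (simp add: power3_eq_cube)
  \<comment> \<open>Write w = m a b. Removing the central m, a b is central, so a commutes with y
    and must be 1 because x and y do not commute; likewise b = 1.\<close>
  have centerN: "w \<in> N" if w: "w \<in> carrier G" and wc: "\<And>g. g \<in> carrier G \<Longrightarrow> g \<otimes> w = w \<otimes> g" for w
  proof -
    obtain m a b where mab: "m \<in> N" "a \<in> ?X" "b \<in> ?Y" "w = m \<otimes> (a \<otimes> b)"
      using w unfolding full[symmetric] by (auto simp: mem_set_mult)
    obtain i where i: "a = x [^] (i::nat)" by (rule generate_singE[OF fin x(1) mab(2)])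
    obtain j where j: "b = y [^] (j::nat)" by (rule generate_singE[OF fin y(1) mab(3)])
    have c: "m \<in> carrier G" "a \<in> carrier G" "b \<in> carrier G" using mab(1) x y i j by auto
    have abc: "g \<otimes> (a \<otimes> b) = (a \<otimes> b) \<otimes> g" if g: "g \<in> carrier G" for g
    proof -
      have "m \<otimes> (g \<otimes> (a \<otimes> b)) = g \<otimes> w" using central[OF mab(1) g] c g by (simp add: mab(4) m_assoc[symmetric])
      also have "\<dots> = m \<otimes> ((a \<otimes> b) \<otimes> g)" using wc[OF g] c g by (simp add: mab(4) m_assoc)
      finally show ?thesis using c g by simp
    qed
    have "a = \<one>"
    proof (rule ccontr)
      assume "a \<noteq> \<one>"
      have "b \<otimes> y = y \<otimes> b" using y(1) unfolding j by (metis nat_pow_Suc nat_pow_Suc2)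
      then have "(y \<otimes> a) \<otimes> b = (a \<otimes> y) \<otimes> b" using abc[OF y(1)] c y(1) by (simp add: m_assoc)
      then have "a \<otimes> y = y \<otimes> a" using c y(1) by simp
      then show False using commute_if_power_commutes[OF fin p(1) x y(1), of i] \<open>a \<noteq> \<one>\<close> i nc by simp
    qed
    moreover have "b = \<one>"
    proof (rule ccontr)
      assume "b \<noteq> \<one>"
      have "b \<otimes> x = x \<otimes> b" using abc[OF x(1)] \<open>a = \<one>\<close> c by simp
      then show False using commute_if_power_commutes[OF fin p(1) y x(1), of j] \<open>b \<noteq> \<one>\<close> j nc by simp
    qed
    ultimately show "w \<in> N" using mab(1,4) c by simp
  qed
  \<comment> \<open>In class two with odd p, the elements with g^p = 1 form a subgroup: the
    correction term is a power of c to p choose 2, a multiple of p. It contains \<open>N\<close>, x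
    and y, hence everything.\<close>
  have expo: "g [^] p = \<one>" if "g \<in> carrier G" for g
  proof -
    have E: "subgroup {g \<in> carrier G. g [^] p = \<one>} G" (is "subgroup ?E G")
    proof (rule subgroupI)
      show "inv a \<in> ?E" if "a \<in> ?E" for a using that by (simp add: nat_pow_inv)
      show "a \<otimes> b \<in> ?E" if ab: "a \<in> ?E" "b \<in> ?E" for a b
      proof -
        have abc: "a \<in> carrier G" "b \<in> carrier G" using ab by auto
        define c where "c = inv b \<otimes> inv a \<otimes> b \<otimes> a"
        have "c = inv b \<otimes> inv a \<otimes> inv (inv b) \<otimes> inv (inv a)" using abc by (simp add: c_def)
        then have "c \<in> N" using abel[of "inv b" "inv a"] abc by simp
        then have cc: "c \<in> carrier G" and cN: "\<And>g. g \<in> carrier G \<Longrightarrow> c \<otimes> g = g \<otimes> c"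
          using central[of c] by auto
        have "b \<otimes> a = a \<otimes> b \<otimes> c"
          using abc by (simp add: c_def m_assoc) (simp add: m_assoc[symmetric])
        then have "(a \<otimes> b) [^] p = a [^] p \<otimes> b [^] p \<otimes> c [^] (p choose 2)"
          using mult_pow_class_two[OF abc cc] cN abc by simp
        moreover have "p dvd p choose 2"
        proof -
          have "even (p - 1)" using p(2) by simp
          then obtain t where "p - 1 = 2 * t" by blast
          then show ?thesis by (simp add: choose_two)
        qed
        then have "c [^] (p choose 2) = \<one>"
          using ord_dvd_card_subgroup[OF N.is_subgroup \<open>c \<in> N\<close>] N(2) cc
          by (simp add: pow_eq_id) (rule dvd_trans)
        ultimately show ?thesis using ab by simp
      qed
    qed auto
    have "H \<subseteq> ?E" if "subgroup H G" "card H = p" for H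
      using ord_dvd_card_subgroup[OF that(1)] that(2) subgroup.mem_carrier[OF that(1)] by (auto simp: pow_eq_id)
    then have "N \<subseteq> ?E" "?X \<subseteq> ?E" "?Y \<subseteq> ?E" using N.is_subgroup N(2) X Y by blast+
    then have "N <#> (?X <#> ?Y) \<subseteq> ?E"
      by (intro set_mult_subset[OF E])
    then show ?thesis using that full by blast
  qed
  define \<M> where "\<M> = {M. M \<lhd> G} - {{\<one>}, N, carrier G}"
  have finNorm: "finite {M. M \<lhd> G}"
    by (rule finite_subset[OF _ finite_subgroups[OF fin]]) (auto dest: normal_imp_subgroup)
  have pcard: "\<exists>k. card H = p ^ k" if "subgroup H G" for H
    using card_subgroup_dvd[OF that] ord divides_primepow_nat[OF p(1)] by auto
  \<comment> \<open>A nontrivial normal subgroup of a p-group meets the centre, and the centre lies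
    in \<open>N\<close>, which has prime order.\<close>
  have NsubM: "N \<subseteq> M" if M: "M \<lhd> G" "M \<noteq> {\<one>}" for M
  proof -
    obtain z where z: "z \<in> M" "z \<noteq> \<one>" "\<And>g. g \<in> carrier G \<Longrightarrow> g \<otimes> z = z \<otimes> g"
      using p_group_center[OF p(1) ord M] by blast
    have sM: "subgroup M G" using M(1) by (rule normal_imp_subgroup)
    have "z \<in> N" using z subgroup.mem_carrier[OF sM] by (intro centerN) auto
    then have "generate G {z} = N" using generate_eq_prime_card[OF N.is_subgroup N(2) p(1)] z(2) by simp
    then show ?thesis using generate_subgroup_incl[OF _ sM, of "{z}"] z(1) by simp
  qed
  have "\<exists>w. w \<in> M \<and> w \<notin> N" if "M \<in> \<M>" for M
    using that NsubM[of M] by (auto simp: \<M>_def)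
  then obtain w where w: "\<And>M. M \<in> \<M> \<Longrightarrow> w M \<in> M \<and> w M \<notin> N" by metis
  have wc: "w M \<in> carrier G" if "M \<in> \<M>" for M
  proof -
    have "subgroup M G" using that by (intro normal_imp_subgroup) (simp add: \<M>_def)
    then show ?thesis using w[OF that] subgroup.mem_carrier by metis
  qed
  \<comment> \<open>Were the subgroups chosen in M and M' conjugate, \<open>w M\<close> would lie in
    both, so M \<inter> M' would be strictly larger than \<open>N\<close> and have order at least
    p^2. Proper subgroups have order at most p^2, so M = M'.\<close>
  have inj: "inj_on (\<lambda>M. conj_class G (generate G {w M})) \<M>"
  proof (rule inj_onI)
    fix M M' assume M: "M \<in> \<M>" and M': "M' \<in> \<M>"
      and eq: "conj_class G (generate G {w M}) = conj_class G (generate G {w M'})"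
    have nM: "M \<lhd> G" "M' \<lhd> G" and ne: "M \<noteq> {\<one>}" "M' \<noteq> {\<one>}" "M \<noteq> carrier G" "M' \<noteq> carrier G"
      using M M' by (auto simp: \<M>_def)
    have sM: "subgroup M G" "subgroup M' G" using nM normal_imp_subgroup by auto
    have "generate G {w M} \<in> conj_class G (generate G {w M'})"
      using conj_class_self[OF cyclic_subgroup[OF wc[OF M]]] eq by simp
    then obtain g where g: "g \<in> carrier G" "generate G {w M} = (\<lambda>h. g \<otimes> h \<otimes> inv g) ` generate G {w M'}"
      by (auto simp: conj_class_def)
    have "generate G {w M'} \<subseteq> M'" using w[OF M'] generate_subgroup_incl[OF _ sM(2), of "{w M'}"] by simp
    then have "generate G {w M} \<subseteq> (\<lambda>h. g \<otimes> h \<otimes> inv g) ` M'" unfolding g(2) by (rule image_mono)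
    then have "w M \<in> M'" using normal_conj_image[OF nM(2) g(1)] generate_sing_self[of "w M"] by blast
    then have sub: "N \<subset> M \<inter> M'"
      using w[OF M] NsubM[OF nM(1) ne(1)] NsubM[OF nM(2) ne(2)] by blast
    have sI: "subgroup (M \<inter> M') G" using sM by (rule subgroups_Inter_pair)
    have ge: "p ^ 2 \<le> card (M \<inter> M')"
    proof -
      obtain k where k: "card (M \<inter> M') = p ^ k" using pcard[OF sI] by blast
      have "p ^ 1 < p ^ k"
        using psubset_card_mono[OF finite_subgroup[OF fin sI] sub] k N(2) by simp
      then have "1 < k" using pp by (metis power_strict_increasing_iff)
      then show ?thesis unfolding k using pp by (intro power_increasing) auto
    qed
    have le: "card K \<le> p ^ 2" if K: "subgroup K G" "K \<noteq> carrier G" for K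
    proof -
      obtain k where k: "card K = p ^ k" using pcard[OF K(1)] by blast
      have "card K < order G"
        unfolding order_def using K fin subgroup.subset[OF K(1)] by (intro psubset_card_mono) auto
      then have "p ^ k < p ^ 3" using k le3 by simp
      then have "k < 3" using pp by (metis power_strict_increasing_iff)
      then show ?thesis unfolding k using pp by (intro power_increasing) auto
    qed
    have "M \<inter> M' = M" using ge le[OF sM(1) ne(3)] finite_subgroup[OF fin sM(1)] by (intro card_seteq) auto
    moreover have "M \<inter> M' = M'" using ge le[OF sM(2) ne(4)] finite_subgroup[OF fin sM(2)] by (intro card_seteq) auto
    ultimately show "M = M'" by simp
  qed
  \<comment> \<open>The chosen subgroup has order p by \<open>expo\<close> and differs from
    \<open>N\<close>, so it is not normal, as normality would put \<open>N\<close> inside it. Its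
    class size is an odd number other than 1.\<close>
  have big: "3 \<le> card (conj_class G (generate G {w M}))" if M: "M \<in> \<M>" for M
  proof -
    let ?W = "generate G {w M}"
    have W: "subgroup ?W G" using cyclic_subgroup[OF wc[OF M]] .
    have "w M \<noteq> \<one>" using w[OF M] N.one_closed by metis
    then have "ord (w M) = p"
      using expo[OF wc[OF M]] p(1) wc[OF M] by (metis ord_eq_1 pow_eq_id prime_nat_iff)
    then have cW: "card ?W = p" using generate_pow_card[OF wc[OF M]] by simp
    have "\<not> ?W \<lhd> G"
    proof
      assume "?W \<lhd> G"
      then have "N \<subseteq> ?W" using \<open>w M \<noteq> \<one>\<close> generate_sing_self[of "w M"] by (intro NsubM) auto
      then have "N = ?W" using cW N(2) finite_subgroup[OF fin W] by (intro card_subset_eq) auto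
      then show False using w[OF M] generate_sing_self[of "w M"] by blast
    qed
    then have "card (conj_class G ?W) \<noteq> 1" using normal_iff_card_conj_class[OF W] by simp
    moreover have "card (conj_class G ?W) dvd p ^ n" using card_conj_class_dvd[OF W] ord by simp
    then have "odd (card (conj_class G ?W))" using p(2) by (metis dvd_trans even_power)
    ultimately show ?thesis by (cases "card (conj_class G ?W)" rule: nat.exhaust) (auto elim!: oddE)
  qed
  have "inj_on (conj_class G) ((\<lambda>M. generate G {w M}) ` \<M>)" using inj by (auto simp: inj_on_def)
  then have "3 * card ((\<lambda>M. generate G {w M}) ` \<M>) < card {M. M \<lhd> G}"
    using big wc cyclic_subgroup by (intro d_prime_bound[OF fin d]) auto
  moreover have "card ((\<lambda>M. generate G {w M}) ` \<M>) = card \<M>"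
    using inj by (intro card_image) (auto simp: inj_on_def)
  moreover have "card {M. M \<lhd> G} \<le> card \<M> + 3"
  proof -
    have "card {{\<one>}, N, carrier G} \<le> 3" by (simp add: card_insert_if)
    moreover have "card {M. M \<lhd> G} - card {{\<one>}, N, carrier G} \<le> card \<M>"
      unfolding \<M>_def by (intro diff_card_le_card_Diff) simp
    ultimately show ?thesis by linarith
  qed
  moreover have "2 \<le> card \<M>"
  proof -
    \<comment> \<open>N\<langle>a\<rangle> is normal because it contains all commutators, and it
      centralizes a, so b stays outside. Using both orders of the pair gives two different members
      of \<M>, told apart by y.\<close>
    have mem: "N <#> generate G {a} \<in> \<M>" "b \<notin> N <#> generate G {a}"
      if ab: "(a, b) = (x, y) \<or> (a, b) = (y, x)" for a b
    proof -
      have ac: "a \<in> carrier G" "b \<in> carrier G" "a \<otimes> b \<noteq> b \<otimes> a" using ab x y nc by auto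
      let ?M = "N <#> generate G {a}"
      note cyc = cyclic_subgroup[OF ac(1)]
      have M: "subgroup ?M G" using mult_norm_subgroup[OF N(1) cyc] .
      have sub: "N \<subseteq> ?M" "generate G {a} \<subseteq> ?M" using subset_set_mult[OF N.is_subgroup cyc] by auto
      have "?M \<lhd> G"
        using abel sub subgroup.mem_carrier[OF M] by (intro subgroup_normal_if_commutators[OF M]) auto
      have comm: "h \<otimes> a = a \<otimes> h" if h: "h \<in> ?M" for h
      proof -
        obtain m k where mk: "m \<in> N" "k \<in> generate G {a}" "h = m \<otimes> k" using h by (auto simp: mem_set_mult)
        obtain i where i: "k = a [^] (i::nat)" by (rule generate_singE[OF fin ac(1) mk(2)])
        have ka: "k \<otimes> a = a \<otimes> k" using ac(1) unfolding i by (metis nat_pow_Suc nat_pow_Suc2)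
        have c: "m \<in> carrier G" "k \<in> carrier G" using mk(1) ac(1) i by auto
        have "h \<otimes> a = (m \<otimes> a) \<otimes> k" using c ac(1) ka by (simp add: mk(3) m_assoc)
        also have "m \<otimes> a = a \<otimes> m" using central[OF mk(1) ac(1)] by simp
        finally show ?thesis using c ac(1) by (simp add: mk(3) m_assoc)
      qed
      show nb: "b \<notin> ?M" using comm[of b] ac(3) by auto
      have "?M \<noteq> N"
      proof
        assume "?M = N"
        then have "a \<in> N" using sub(2) generate_sing_self[of a] by blast
        then show False using central[OF _ ac(2), of a] ac(3) by simp
      qed
      moreover have "?M \<noteq> {\<one>}" using sub(1) N(2) pp by (metis card_mono card_1_singleton_iff finite.intros is_singletonI is_singleton_altdef linorder_not_less)
      moreover have "?M \<noteq> carrier G" using nb ac(2) by blast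
      ultimately show "?M \<in> \<M>" using \<open>?M \<lhd> G\<close> by (simp add: \<M>_def)
    qed
    have "y \<in> N <#> ?Y" using subset_set_mult[OF N.is_subgroup Y(1)] generate_sing_self[of y] by blast
    then have "N <#> ?X \<noteq> N <#> ?Y" using mem(2)[of x y] by auto
    then have "card {N <#> ?X, N <#> ?Y} = 2" by simp
    moreover have "{N <#> ?X, N <#> ?Y} \<subseteq> \<M>" using mem(1) by blast
    moreover have "finite \<M>" unfolding \<M>_def using finNorm by simp
    ultimately show ?thesis by (metis card_mono)
  qed
  ultimately show False by linarith
qed

end

section \<open>Permuting subgroups of p-groups for odd p, and the modular law\<close>

definition cyclic_permute :: "('a, 'b) monoid_scheme \<Rightarrow> bool" where
  "cyclic_permute G \<longleftrightarrow> (\<forall>x\<in>carrier G. \<forall>y\<in>carrier G. group.permute G x y)"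

context group begin

lemma permute_subgroup_iff:
  assumes "subgroup H G" "x \<in> H" "y \<in> H"
  shows "group.permute (G\<lparr>carrier := H\<rparr>) x y \<longleftrightarrow> permute x y"
  using assms generate_consistent[of "{x}" H] generate_consistent[of "{y}" H]
  by (simp add: group.permute_def[OF subgroup_imp_group] permute_def)

lemma exists_central_prime_order:
  assumes p: "Factorial_Ring.prime p" and ord: "order G = p ^ n" and nontriv: "carrier G \<noteq> {\<one>}"
  obtains z where "z \<in> carrier G" "ord z = p" "\<And>g. g \<in> carrier G \<Longrightarrow> g \<otimes> z = z \<otimes> g"
proof -
  have fin: "finite (carrier G)" using ord p by (metis order_gt_0_iff_finite prime_gt_0_nat zero_less_power)
  obtain z where z: "z \<in> carrier G" "z \<noteq> \<one>" "\<And>g. g \<in> carrier G \<Longrightarrow> g \<otimes> z = z \<otimes> g"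
    using p_group_center[OF p ord normal_self nontriv] by blast
  obtain k where k: "ord z = p ^ k"
    using ord_dvd_group_order[OF z(1)] ord divides_primepow_nat[OF p] by auto
  moreover have "ord z \<noteq> 1" using z(1,2) ord_eq_1 by simp
  ultimately obtain l where l: "ord z = p * p ^ l" by (cases k) auto
  have pp: "p > 0" using p by (rule prime_gt_0_nat)
  have "ord (z [^] (p ^ l)) = p" using z(1) l pp by (subst ord_pow) auto
  moreover have "g \<otimes> z [^] (p ^ l) = z [^] (p ^ l) \<otimes> g" if "g \<in> carrier G" for g
    using pow_comm[OF z(1) that z(3)[OF that, symmetric]] by simp
  ultimately show thesis using that z(1) by blast
qed

text \<open>Unlike commuting, permuting modulo \<open>N\<close> is not a statement about particular
  elements of \<open>N\<close>. The quotient is therefore supplied explicitly as a group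
  \<open>T\<close> with a surjection.\<close>

lemma cyclic_permute_step:
  assumes p: "Factorial_Ring.prime p" "odd p" and ord: "order G = p ^ n" and d: "d_prime G > 2/3"
    and sub: "\<And>H. subgroup H G \<Longrightarrow> H \<noteq> carrier G \<Longrightarrow> cyclic_permute (G\<lparr>carrier := H\<rparr>)"
    and quot: "\<And>N. N \<lhd> G \<Longrightarrow> N \<noteq> {\<one>} \<Longrightarrow> \<exists>(T :: nat monoid) f. group_hom G T f \<and>
      f ` carrier G = carrier T \<and> kernel G T f = N \<and> cyclic_permute T"
  shows "cyclic_permute G"
proof (rule ccontr)
  assume "\<not> cyclic_permute G"
  then obtain x y where xy: "x \<in> carrier G" "y \<in> carrier G" "\<not> permute x y"
    and min: "\<And>a b. a \<in> carrier G \<Longrightarrow> b \<in> carrier G \<Longrightarrow> \<not> permute a b \<Longrightarrow> ord x * ord y \<le> ord a * ord b"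
    using ex_has_least_nat[of "\<lambda>(x, y). x \<in> carrier G \<and> y \<in> carrier G \<and> \<not> permute x y" _ "\<lambda>(x, y). ord x * ord y"]
    unfolding cyclic_permute_def by fastforce
  have fin: "finite (carrier G)" using ord p by (metis order_gt_0_iff_finite prime_gt_0_nat zero_less_power)
  let ?X = "generate G {x}" and ?Y = "generate G {y}"
  note X = cyclic_subgroup[OF xy(1)] and Y = cyclic_subgroup[OF xy(2)]
  have gen: "W = carrier G" if W: "subgroup W G" "x \<in> W" "y \<in> W" for W
  proof (rule ccontr)
    assume "W \<noteq> carrier G"
    then have "group.permute (G\<lparr>carrier := W\<rparr>) x y" using sub[OF W(1)] W by (simp add: cyclic_permute_def)
    then show False using permute_subgroup_iff[OF W] xy(3) by simp
  qed
  \<comment> \<open>Modulo \<open>K\<close> the two cyclic subgroups permute, so their product is a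
    subgroup. Its preimage contains x and y, hence is everything.\<close>
  have full: "K <#> (?X <#> ?Y) = carrier G" if K: "K \<lhd> G" "K \<noteq> {\<one>}" for K
  proof -
    obtain T :: "nat monoid" and f where f: "group_hom G T f" and
      T: "f ` carrier G = carrier T" "kernel G T f = K" "cyclic_permute T" using quot[OF K] by blast
    interpret f: group_hom G T f by fact
    interpret K: normal K G by fact
    have fx: "f x \<in> carrier T" "f y \<in> carrier T" using xy by simp_all
    have img: "f ` generate G {a} = generate T {f a}" if "a \<in> carrier G" for a
      using f.generate_img[of "{a}"] that by simp
    let ?A = "generate T {f x} <#>\<^bsub>T\<^esub> generate T {f y}"
    have A: "subgroup ?A T"
      using T(3) fx f.H.subgroup_set_mult_if_comm[OF f.H.cyclic_subgroup[OF fx(1)] f.H.cyclic_subgroup[OF fx(2)]]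
      by (simp add: cyclic_permute_def f.H.permute_def)
    have "f x \<in> ?A" "f y \<in> ?A"
      using f.H.subset_set_mult[OF f.H.cyclic_subgroup[OF fx(1)] f.H.cyclic_subgroup[OF fx(2)]] f.H.generate_sing_self
      by blast+
    then have W: "{g \<in> carrier G. f g \<in> ?A} = carrier G"
      using xy by (intro gen f.vimage_subgroup[OF A]) auto
    have "g \<in> K <#> (?X <#> ?Y)" if g: "g \<in> carrier G" for g
    proof -
      have "f g \<in> f ` ?X <#>\<^bsub>T\<^esub> f ` ?Y" using W g xy by (auto simp: img)
      then obtain a b where ab: "a \<in> ?X" "b \<in> ?Y" "f g = f a \<otimes>\<^bsub>T\<^esub> f b" by (auto simp: f.H.mem_set_mult)
      have c: "a \<in> carrier G" "b \<in> carrier G" using ab X Y subgroup.mem_carrier by metis+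
      have "f (g \<otimes> inv (a \<otimes> b)) = \<one>\<^bsub>T\<^esub>" using c g ab(3) by simp
      then have "g \<otimes> inv (a \<otimes> b) \<in> K" unfolding T(2)[symmetric] using g c by (simp add: kernel_def)
      moreover have "g = (g \<otimes> inv (a \<otimes> b)) \<otimes> (a \<otimes> b)" using g c by (simp add: m_assoc)
      moreover have "a \<otimes> b \<in> ?X <#> ?Y" using ab by (auto simp: mem_set_mult)
      ultimately show ?thesis unfolding mem_set_mult[of g] by blast
    qed
    moreover have "K <#> (?X <#> ?Y) \<subseteq> carrier G"
      using K.subset setmult_subset_G subgroup.subset[OF X] subgroup.subset[OF Y] by simp
    ultimately show ?thesis by blast
  qed
  \<comment> \<open>If \<open>K\<close> lay in XY, then every k a b = a (a^-1 k a) b would lie in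
    X(XY)Y = XY. By \<open>full\<close>, XY would be the whole group, a subgroup, and x and y would
    permute.\<close>
  have nc: "\<not> K \<subseteq> ?X <#> ?Y" if K: "K \<lhd> G" "K \<noteq> {\<one>}" for K
  proof
    assume sub: "K \<subseteq> ?X <#> ?Y"
    interpret K: normal K G by fact
    have "g \<in> ?X <#> ?Y" if g: "g \<in> carrier G" for g
    proof -
      obtain k a b where kab: "k \<in> K" "a \<in> ?X" "b \<in> ?Y" "g = k \<otimes> (a \<otimes> b)"
        using g unfolding full[OF K, symmetric] by (auto simp: mem_set_mult)
      have c: "k \<in> carrier G" "a \<in> carrier G" "b \<in> carrier G"
        using kab X Y K.mem_carrier subgroup.mem_carrier by metis+
      have "inv a \<otimes> k \<otimes> a \<in> K" using K.inv_op_closed1[OF c(2) kab(1)] .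
      then have "inv a \<otimes> k \<otimes> a \<in> ?X <#> ?Y" using sub by blast
      then obtain a' b' where ab': "a' \<in> ?X" "b' \<in> ?Y" "inv a \<otimes> k \<otimes> a = a' \<otimes> b'"
        unfolding mem_set_mult by blast
      have c': "a' \<in> carrier G" "b' \<in> carrier G" using ab' X Y subgroup.mem_carrier by metis+
      have "g = a \<otimes> (inv a \<otimes> k \<otimes> a) \<otimes> b" using c by (simp add: kab(4) m_assoc) (simp add: m_assoc[symmetric])
      also have "\<dots> = (a \<otimes> a') \<otimes> (b' \<otimes> b)" unfolding ab'(3) using c c' by (simp add: m_assoc)
      finally show ?thesis
        using subgroup.m_closed[OF X kab(2) ab'(1)] subgroup.m_closed[OF Y ab'(2) kab(3)] by (auto simp: mem_set_mult)
    qed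
    then have "?X <#> ?Y = carrier G"
      using setmult_subset_G subgroup.subset[OF X] subgroup.subset[OF Y] by blast
    then have "subgroup (?X <#> ?Y) G" by (simp add: subgroup_self)
    then show False using set_mult_comm_if_subgroup[OF X Y] xy(3) by (simp add: permute_def)
  qed
  have min': "permute a b" if "a \<in> carrier G" "b \<in> carrier G" "ord a * ord b < ord x * ord y" for a b
    using min[OF that(1,2)] that(3) by (meson not_le)
  have ordx: "ord x = p" by (rule minimal_nonpermuting_orders(1)[OF p(1) ord xy min' gen nc])
  have ordy: "ord y = p" by (rule minimal_nonpermuting_orders(2)[OF p(1) ord xy min' gen nc])
  have "x \<noteq> \<one>" using ordx p(1) by auto
  then have "carrier G \<noteq> {\<one>}" using xy by auto
  then obtain z where z: "z \<in> carrier G" "ord z = p" "\<And>g. g \<in> carrier G \<Longrightarrow> g \<otimes> z = z \<otimes> g"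
    using exists_central_prime_order[OF p(1) ord] by blast
  let ?N = "generate G {z}"
  have N: "?N \<lhd> G" "card ?N = p"
    using central_generate_normal(1)[OF fin z(1,3)] generate_pow_card[OF z(1)] z(2) by auto
  have Nne: "?N \<noteq> {\<one>}" using N(2) p(1) by auto
  obtain T :: "nat monoid" and f where f: "group_hom G T f" and
    T: "f ` carrier G = carrier T" "kernel G T f = ?N" "cyclic_permute T" using quot[OF N(1) Nne] by blast
  interpret f: group_hom G T f by fact
  have "order T dvd p ^ n" using f.order_eq_kernel[OF fin T(1)] ord by (metis dvd_triv_left)
  then obtain m where m: "order T = p ^ m" using divides_primepow_nat[OF p(1)] by auto
  \<comment> \<open>The images have order 1 or p. In \<open>T\<close> they permute, and permuting
    elements of order p commute.\<close>
  have "f x \<otimes>\<^bsub>T\<^esub> f y = f y \<otimes>\<^bsub>T\<^esub> f x"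
  proof (cases "f x = \<one>\<^bsub>T\<^esub> \<or> f y = \<one>\<^bsub>T\<^esub>")
    case False
    then have "f.H.ord (f x) = p" "f.H.ord (f y) = p"
      using f.ord_hom_dvd xy ordx ordy p(1) f.H.ord_eq_1 by (metis f.hom_closed prime_nat_iff)+
    then show ?thesis
      using f.H.permute_prime_order_commute[OF p(1) m] T(3) xy by (simp add: cyclic_permute_def)
  qed (use xy in auto)
  \<comment> \<open>The preimage of the centralizer of f x contains x and y, so it is everything.
    The same for f y, and then for an arbitrary f g, shows that \<open>T\<close> is abelian, which
    puts all commutators into the kernel.\<close>
  then have "{g \<in> carrier G. f g \<in> {t \<in> carrier T. t \<otimes>\<^bsub>T\<^esub> f x = f x \<otimes>\<^bsub>T\<^esub> t}} = carrier G"
    using xy by (intro gen f.vimage_subgroup f.H.centralizer_subgroup) auto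
  then have fx: "f g \<otimes>\<^bsub>T\<^esub> f x = f x \<otimes>\<^bsub>T\<^esub> f g" if "g \<in> carrier G" for g using that by blast
  from \<open>f x \<otimes>\<^bsub>T\<^esub> f y = f y \<otimes>\<^bsub>T\<^esub> f x\<close>
  have "{g \<in> carrier G. f g \<in> {t \<in> carrier T. t \<otimes>\<^bsub>T\<^esub> f y = f y \<otimes>\<^bsub>T\<^esub> t}} = carrier G"
    using xy by (intro gen f.vimage_subgroup f.H.centralizer_subgroup) auto
  then have fy: "f g \<otimes>\<^bsub>T\<^esub> f y = f y \<otimes>\<^bsub>T\<^esub> f g" if "g \<in> carrier G" for g using that by blast
  have "f g \<otimes>\<^bsub>T\<^esub> f h = f h \<otimes>\<^bsub>T\<^esub> f g" if g: "g \<in> carrier G" and h: "h \<in> carrier G" for g h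
  proof -
    have "{h \<in> carrier G. f h \<in> {t \<in> carrier T. t \<otimes>\<^bsub>T\<^esub> f g = f g \<otimes>\<^bsub>T\<^esub> t}} = carrier G"
      using xy g fx fy by (intro gen f.vimage_subgroup f.H.centralizer_subgroup) auto
    then have "f h \<otimes>\<^bsub>T\<^esub> f g = f g \<otimes>\<^bsub>T\<^esub> f h" using h by blast
    then show ?thesis by simp
  qed
  then have abel: "g \<otimes> h \<otimes> inv g \<otimes> inv h \<in> ?N" if "g \<in> carrier G" "h \<in> carrier G" for g h
    using f.commutator_mem_kernel_iff T(2) that by metis
  have "x \<otimes> y = y \<otimes> x"
    using prime_order_pair_commutes[OF p ord d xy(1) ordx xy(2) ordy N full[OF N(1) Nne]
        central_generate_normal(2)[OF fin z(1,3)] abel] by blast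
  then show False using commute_imp_permute[OF fin xy(1,2)] xy(3) by blast
qed

end

lemma conj_dense_imp_cyclic_permute_nat:
  fixes S :: "nat monoid"
  assumes "group S" "conj_dense S" "Factorial_Ring.prime p" "odd p" "order S = p ^ n"
  shows "cyclic_permute S"
  using assms
proof (induction "order S" arbitrary: S n rule: less_induct)
  case less
  interpret group S by fact
  note p = less.prems(3)
  have fin: "finite (carrier S)"
    using less.prems(5) p by (metis order_gt_0_iff_finite prime_gt_0_nat zero_less_power)
  have pow: "\<exists>k. m = p ^ k" if "m dvd order S" for m
    using that less.prems(5) divides_primepow_nat[OF p] by auto
  show ?case
  proof (rule cyclic_permute_step[OF p less.prems(4,5) conj_dense_d_prime[OF less.prems(2) fin]])
    fix H assume H: "subgroup H S" "H \<noteq> carrier S"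
    have lt: "order (S\<lparr>carrier := H\<rparr>) < order S"
      unfolding order_def using H fin subgroup.subset[OF H(1)] by (auto intro!: psubset_card_mono)
    obtain k where "order (S\<lparr>carrier := H\<rparr>) = p ^ k"
      using pow[OF card_subgroup_dvd[OF H(1)]] by (auto simp: order_def)
    then show "cyclic_permute (S\<lparr>carrier := H\<rparr>)"
      using less.hyps[OF lt subgroup_imp_group[OF H(1)] conj_dense_subgroup[OF less.prems(2) H(1)] p less.prems(4)] by blast
  next
    fix N
    assume N: "N \<lhd> S" "N \<noteq> {\<one>\<^bsub>S\<^esub>}"
    obtain T :: "nat monoid" and f where f: "group_hom S T f" and T: "f ` carrier S = carrier T" "kernel S T f = N"
      "order T < order S" "order T dvd order S"
      using exists_smaller_nat_quotient[OF fin N] .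
    interpret f: group_hom S T f by fact
    obtain k where "order T = p ^ k" using pow[OF T(4)] by blast
    then have "cyclic_permute T"
      using less.hyps[OF T(3) _ f.conj_dense_image[OF less.prems(2) T(1)] p less.prems(4)] f.H.is_group by blast
    then show "\<exists>(T :: nat monoid) f. group_hom S T f \<and> f ` carrier S = carrier T \<and> kernel S T f = N \<and> cyclic_permute T"
      using f T(1,2) by blast
  qed
qed

lemma (in group) conj_dense_imp_cyclic_permute:
  assumes d: "conj_dense G" and p: "Factorial_Ring.prime p" "odd p" and ord: "order G = p ^ n"
  shows "cyclic_permute G"
proof -
  have fin: "finite (carrier G)"
    using ord p by (metis order_gt_0_iff_finite prime_gt_0_nat zero_less_power)
  obtain S :: "nat monoid" and f where S: "group S" "f \<in> epi G S" "kernel G S f = {\<one>}"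
    using exists_nat_quotient[OF fin one_is_normal] .
  interpret f: group_hom G S f using S by (intro epi_group_hom) auto
  have onto: "f ` carrier G = carrier S" using S(2) by (simp add: epi_def)
  have inj: "inj_on f (carrier G)" using f.inj_iff_trivial_ker S(3) by simp
  have "order S = p ^ n" using f.order_eq_kernel[OF fin onto] S(3) ord by simp
  then have perm: "cyclic_permute S"
    using conj_dense_imp_cyclic_permute_nat S(1) f.conj_dense_image[OF d onto] p by blast
  have "permute x y" if xy: "x \<in> carrier G" "y \<in> carrier G" for x y
  proof -
    let ?X = "generate G {x}" and ?Y = "generate G {y}"
    have sub: "?X \<subseteq> carrier G" "?Y \<subseteq> carrier G" using xy by (auto intro!: generate_incl)
    have img: "f ` generate G {a} = generate S {f a}" if "a \<in> carrier G" for a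
      using f.generate_img[of "{a}"] that by simp
    have "f.H.permute (f x) (f y)" using perm xy by (simp add: cyclic_permute_def)
    then have "f ` (?X <#> ?Y) = f ` (?Y <#> ?X)"
      using set_mult_hom[OF f.homh] sub xy by (simp add: f.H.permute_def img)
    then show ?thesis
      using inj_on_image_eq_iff[OF inj] setmult_subset_G sub by (simp add: permute_def)
  qed
  then show ?thesis by (simp add: cyclic_permute_def)
qed

text \<open>Elementwise: a b lies in \<langle>a\<rangle>\<langle>b\<rangle> =
  \<langle>b\<rangle>\<langle>a\<rangle>, which is contained in B A.\<close>

lemma (in group) subgroups_permute:
  assumes fin: "finite (carrier G)" and perm: "cyclic_permute G" and H: "subgroup H G" and K: "subgroup K G"
  shows "H <#> K = K <#> H"
proof -
  have "A <#> B \<subseteq> B <#> A" if A: "subgroup A G" and B: "subgroup B G" for A B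
  proof
    fix x assume "x \<in> A <#> B"
    then obtain a b where ab: "a \<in> A" "b \<in> B" "x = a \<otimes> b" by (auto simp: mem_set_mult)
    have c: "a \<in> carrier G" "b \<in> carrier G" using ab A B subgroup.mem_carrier by metis+
    have "x \<in> generate G {a} <#> generate G {b}"
      using ab(3) generate_sing_self by (auto simp: mem_set_mult)
    then have "x \<in> generate G {b} <#> generate G {a}"
      using perm c by (simp add: cyclic_permute_def permute_def)
    moreover have "generate G {a} \<subseteq> A" "generate G {b} \<subseteq> B"
      using ab generate_subgroup_incl[OF _ A, of "{a}"] generate_subgroup_incl[OF _ B, of "{b}"] by simp_all
    ultimately show "x \<in> B <#> A" using mono_set_mult by blast
  qed
  then show ?thesis using H K by blast
qed

lemma (in group) modular_subgroup_lattice: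
  assumes perm: "\<And>H K. subgroup H G \<Longrightarrow> subgroup K G \<Longrightarrow> H <#> K = K <#> H"
  shows "modular_lattice (subgroup_lattice G)"
proof -
  let ?L = "subgroup_lattice G"
  interpret L: complete_lattice ?L unfolding subgroup_lattice_def by (rule subgroups_complete_lattice)
  have L: "carrier ?L = {H. subgroup H G}" "le ?L = (\<subseteq>)" by (simp_all add: subgroup_lattice_def)
  have join: "H \<squnion>\<^bsub>?L\<^esub> K = H <#> K" if H: "subgroup H G" and K: "subgroup K G" for H K
  proof -
    have HK: "subgroup (H <#> K) G" using subgroup_set_mult_if_comm[OF H K perm[OF H K]] .
    have lub: "least ?L (H <#> K) (Upper ?L {H, K})"
      using HK subset_set_mult[OF H K] H K set_mult_subset
      by (auto simp: least_def Upper_def L)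
    show ?thesis
      unfolding join_def sup_def by (rule some_equality, rule lub) (rule L.least_unique[OF _ lub])
  qed
  have meet: "H \<sqinter>\<^bsub>?L\<^esub> K = H \<inter> K" if H: "subgroup H G" and K: "subgroup K G" for H K
  proof -
    have glb: "greatest ?L (H \<inter> K) (Lower ?L {H, K})"
      using subgroups_Inter_pair[OF H K] H K by (auto simp: greatest_def Lower_def L)
    show ?thesis
      unfolding meet_def inf_def by (rule some_equality, rule glb) (rule L.greatest_unique[OF _ glb])
  qed
  \<comment> \<open>Dedekind's law: in x = a b with x and a in \<open>C\<close>, also b = a^-1 x is
    in \<open>C\<close>.\<close>
  have "A <#> (B \<inter> C) = (A <#> B) \<inter> C" if A: "subgroup A G" and B: "subgroup B G" and C: "subgroup C G" and "A \<subseteq> C" for A B C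
  proof (intro equalityI subsetI)
    fix x assume "x \<in> A <#> (B \<inter> C)"
    then show "x \<in> (A <#> B) \<inter> C"
      using \<open>A \<subseteq> C\<close> subgroup.m_closed[OF C] by (auto simp: mem_set_mult)
  next
    fix x assume x: "x \<in> (A <#> B) \<inter> C"
    then obtain a b where ab: "a \<in> A" "b \<in> B" "x = a \<otimes> b" by (auto simp: mem_set_mult)
    have c: "a \<in> carrier G" "b \<in> carrier G" using ab A B subgroup.mem_carrier by metis+
    have "b = inv a \<otimes> x" using c by (simp add: ab(3) m_assoc[symmetric])
    moreover have "inv a \<in> C" using ab(1) \<open>A \<subseteq> C\<close> subgroup.m_inv_closed[OF C] by blast
    ultimately have "b \<in> C" using x subgroup.m_closed[OF C] by simp
    then show "x \<in> A <#> (B \<inter> C)" using ab by (auto simp: mem_set_mult)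
  qed
  moreover have "subgroup (H <#> K) G" if "subgroup H G" "subgroup K G" for H K
    using subgroup_set_mult_if_comm[OF that perm[OF that]] .
  ultimately show ?thesis
    unfolding modular_lattice_def L using L.lattice_axioms
    by (auto simp: join meet subgroups_Inter_pair)
qed

subsection \<open>The symmetric group on three letters\<close>

lemma (in comm_group) d_prime_eq_one:
  assumes "finite (carrier G)"
  shows "d_prime G = 1"
proof -
  have "conj_class G H = {H}" if "subgroup H G" for H
    using normal_iff_card_conj_class[OF that] subgroup_imp_normal[OF that] conj_class_self[OF that]
    by (metis card_1_singletonE singletonD)
  then have "conj_class G ` {H. subgroup H G} = (\<lambda>H. {H}) ` {H. subgroup H G}"
    by (intro image_cong) auto
  then have "card (conj_class G ` {H. subgroup H G}) = card {H. subgroup H G}"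
    by (simp add: card_image)
  moreover have "card {H. subgroup H G} \<noteq> 0"
    using finite_subgroups[OF assms] subgroup_self by (auto simp: card_eq_0_iff)
  ultimately show ?thesis by (simp add: d_prime_eq)
qed

text \<open>A quotient by a normal subgroup containing all commutators is abelian, so each of its
  subgroups forms a class of its own. This settles all sections of \<open>S_3\<close> except
  \<open>S_3\<close> itself.\<close>

lemma (in group) d_prime_Mod_eq_one:
  assumes fin: "finite (carrier G)" and N: "N \<lhd> G"
    and comm: "\<And>x y. x \<in> carrier G \<Longrightarrow> y \<in> carrier G \<Longrightarrow> x \<otimes> y \<otimes> inv x \<otimes> inv y \<in> N"
  shows "d_prime (G Mod N) = 1"
proof -
  obtain T :: "nat monoid" and f where T: "group T" "f \<in> epi G T" "kernel G T f = N"
    using exists_nat_quotient[OF fin N] .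
  interpret f: group_hom G T f using T by (intro epi_group_hom) auto
  have onto: "f ` carrier G = carrier T" using T(2) by (simp add: epi_def)
  have "comm_group T"
  proof (rule f.H.group_comm_groupI)
    fix a b assume "a \<in> carrier T" "b \<in> carrier T"
    then obtain x y where "x \<in> carrier G" "y \<in> carrier G" "a = f x" "b = f y"
      unfolding onto[symmetric] by blast
    then show "a \<otimes>\<^bsub>T\<^esub> b = b \<otimes>\<^bsub>T\<^esub> a" using comm f.commutator_mem_kernel_iff T(3) by simp
  qed
  moreover have "finite (carrier T)" using fin by (metis onto finite_imageI)
  ultimately have "d_prime T = 1" by (rule comm_group.d_prime_eq_one)
  moreover have "d_prime (G Mod N) = d_prime T"
    using f.FactGroup_iso[OF onto] T normal.factorgroup_is_group[OF N] by (intro d_prime_iso) simp_all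
  ultimately show ?thesis by simp
qed

lemma (in group) d_prime_Mod_one: "d_prime (G Mod {\<one>}) = d_prime G"
  using d_prime_iso[OF normal.factorgroup_is_group[OF one_is_normal] is_group is_isoI[OF trivial_factor_iso]] .

text \<open>An abstract multiplication table keeps permutations out of the enumeration of subgroups.
  The letters s, t, u stand for the transpositions and c, d for the two 3-cycles.\<close>

locale symmetric_group_3 = group +
  fixes s t u c d
  assumes carrier_eq: "carrier G = {\<one>, s, t, u, c, d}"
    and dist: "distinct [\<one>, s, t, u, c, d]"
    and table:
      "s \<otimes> s = \<one>" "s \<otimes> t = c" "s \<otimes> u = d" "s \<otimes> c = t" "s \<otimes> d = u"
      "t \<otimes> s = d" "t \<otimes> t = \<one>" "t \<otimes> u = c" "t \<otimes> c = u" "t \<otimes> d = s"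
      "u \<otimes> s = c" "u \<otimes> t = d" "u \<otimes> u = \<one>" "u \<otimes> c = s" "u \<otimes> d = t"
      "c \<otimes> s = u" "c \<otimes> t = s" "c \<otimes> u = t" "c \<otimes> c = d" "c \<otimes> d = \<one>"
      "d \<otimes> s = t" "d \<otimes> t = u" "d \<otimes> u = s" "d \<otimes> c = \<one>" "d \<otimes> d = c"
begin

lemma elements_closed [simp]: "s \<in> carrier G" "t \<in> carrier G" "u \<in> carrier G" "c \<in> carrier G" "d \<in> carrier G"
  by (simp_all add: carrier_eq)

lemma inverses [simp]: "inv s = s" "inv t = t" "inv u = u" "inv c = d" "inv d = c"
  by (rule inv_equality; simp add: table)+

lemma elements_distinct [simp]:
  "s \<noteq> \<one>" "t \<noteq> \<one>" "u \<noteq> \<one>" "c \<noteq> \<one>" "d \<noteq> \<one>"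
  "\<one> \<noteq> s" "\<one> \<noteq> t" "\<one> \<noteq> u" "\<one> \<noteq> c" "\<one> \<noteq> d"
  "s \<noteq> t" "s \<noteq> u" "s \<noteq> c" "s \<noteq> d" "t \<noteq> u" "t \<noteq> c" "t \<noteq> d" "u \<noteq> c" "u \<noteq> d" "c \<noteq> d"
  "t \<noteq> s" "u \<noteq> s" "c \<noteq> s" "d \<noteq> s" "u \<noteq> t" "c \<noteq> t" "d \<noteq> t" "c \<noteq> u" "d \<noteq> u" "d \<noteq> c"
  using dist by auto

lemma subgroups_eq:
  "{H. subgroup H G} = {{\<one>}, {\<one>, s}, {\<one>, t}, {\<one>, u}, {\<one>, c, d}, carrier G}"
proof (intro equalityI subsetI)
  fix H assume "H \<in> {H. subgroup H G}"
  then interpret H: subgroup H G by simp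
  have sub: "H \<subseteq> {\<one>, s, t, u, c, d}" using H.subset by (simp add: carrier_eq)
  have 1: "\<one> \<in> H" by simp
  have cl: "x \<otimes> y \<in> H" if "x \<in> H" "y \<in> H" for x y using that by simp
  have "c \<in> H \<longleftrightarrow> d \<in> H" using cl[of c c] cl[of d d] by (auto simp: table)
  moreover have "s \<in> H \<Longrightarrow> t \<in> H \<Longrightarrow> c \<in> H" "s \<in> H \<Longrightarrow> u \<in> H \<Longrightarrow> d \<in> H" "t \<in> H \<Longrightarrow> u \<in> H \<Longrightarrow> c \<in> H"
    using cl[of s t] cl[of s u] cl[of t u] by (simp_all add: table)
  moreover have "s \<in> H \<Longrightarrow> c \<in> H \<Longrightarrow> t \<in> H \<and> u \<in> H" "t \<in> H \<Longrightarrow> c \<in> H \<Longrightarrow> u \<in> H \<and> s \<in> H"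
    "u \<in> H \<Longrightarrow> c \<in> H \<Longrightarrow> s \<in> H \<and> t \<in> H"
    using cl[of s c] cl[of c s] cl[of t c] cl[of c t] cl[of u c] cl[of c u] by (simp_all add: table)
  \<comment> \<open>Two transpositions, or a transposition and a 3-cycle, already produce
    everything; this leaves six membership patterns.\<close>
  ultimately consider
    "s \<notin> H" "t \<notin> H" "u \<notin> H" "c \<notin> H" "d \<notin> H" | "s \<in> H" "t \<notin> H" "u \<notin> H" "c \<notin> H" "d \<notin> H"
    | "s \<notin> H" "t \<in> H" "u \<notin> H" "c \<notin> H" "d \<notin> H" | "s \<notin> H" "t \<notin> H" "u \<in> H" "c \<notin> H" "d \<notin> H"
    | "s \<notin> H" "t \<notin> H" "u \<notin> H" "c \<in> H" "d \<in> H" | "s \<in> H" "t \<in> H" "u \<in> H" "c \<in> H" "d \<in> H"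
    by argo
  then show "H \<in> {{\<one>}, {\<one>, s}, {\<one>, t}, {\<one>, u}, {\<one>, c, d}, carrier G}"
  proof cases
    case 1
    then have "H = {\<one>}" using sub \<open>\<one> \<in> H\<close> by blast
    then show ?thesis by simp
  next
    case 2
    then have "H = {\<one>, s}" using sub \<open>\<one> \<in> H\<close> by blast
    then show ?thesis by simp
  next
    case 3
    then have "H = {\<one>, t}" using sub \<open>\<one> \<in> H\<close> by blast
    then show ?thesis by simp
  next
    case 4
    then have "H = {\<one>, u}" using sub \<open>\<one> \<in> H\<close> by blast
    then show ?thesis by simp
  next
    case 5
    then have "H = {\<one>, c, d}" using sub \<open>\<one> \<in> H\<close> by blast
    then show ?thesis by simp
  next
    case 6
    then have "H = carrier G" unfolding carrier_eq using sub \<open>\<one> \<in> H\<close> by blast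
    then show ?thesis by simp
  qed
next
  fix H assume H: "H \<in> {{\<one>}, {\<one>, s}, {\<one>, t}, {\<one>, u}, {\<one>, c, d}, carrier G}"
  have "subgroup {\<one>, s} G" "subgroup {\<one>, t} G" "subgroup {\<one>, u} G" "subgroup {\<one>, c, d} G"
    by (rule subgroupI; auto simp: table)+
  then show "H \<in> {H. subgroup H G}" using H triv_subgroup subgroup_self by auto
qed

lemma conj_class_reflection:
  assumes "r \<in> {s, t, u}"
  shows "conj_class G {\<one>, r} = {{\<one>, s}, {\<one>, t}, {\<one>, u}}"
  using assms by (elim insertE emptyE; simp add: conj_class_def carrier_eq table insert_commute)

lemma rotations_normal: "{\<one>, c, d} \<lhd> G"
proof (rule normal_invI)
  show "subgroup {\<one>, c, d} G" using subgroups_eq by blast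
  fix g h assume "g \<in> carrier G" "h \<in> {\<one>, c, d}"
  then show "g \<otimes> h \<otimes> inv g \<in> {\<one>, c, d}"
    unfolding carrier_eq by (elim insertE emptyE; simp add: table)
qed

text \<open>Of the six subgroups only the three of order two are conjugate to each other, which
  leaves four classes.\<close>

lemma d_prime_eq_two_thirds: "d_prime G = 2/3"
proof -
  have norm: "conj_class G N = {N}" if "N \<lhd> G" for N
    using normal_conj_image[OF that] by (auto simp: conj_class_def carrier_eq)
  have "conj_class G ` {H. subgroup H G} =
      {{{\<one>}}, {{\<one>, s}, {\<one>, t}, {\<one>, u}}, {{\<one>, c, d}}, {carrier G}}"
    unfolding subgroups_eq image_insert image_empty norm[OF one_is_normal] norm[OF rotations_normal] norm[OF normal_self]
    by (simp add: conj_class_reflection)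
  moreover have "card {{{\<one>}}, {{\<one>, s}, {\<one>, t}, {\<one>, u}}, {{\<one>, c, d}}, {carrier G}} = 4"
    by (simp add: carrier_eq card_insert_if set_eq_subset)
  moreover have "card {H. subgroup H G} = 6"
    unfolding subgroups_eq by (simp add: carrier_eq card_insert_if set_eq_subset)
  ultimately show ?thesis by (simp add: d_prime_eq)
qed

text \<open>Proper subgroups are abelian, and a nontrivial normal subgroup contains the rotations
  and hence all commutators. So every section is abelian with value 1, except the quotient by the
  trivial subgroup.\<close>

lemma d_star_eq_two_thirds: "d_star G = 2/3"
proof -
  have fin: "finite (carrier G)" by (simp add: carrier_eq)
  have ge: "2/3 \<le> d_prime S" if "S \<in> group_sections G" for S
  proof -
    obtain H K where HK: "subgroup H G" "K \<lhd> (G\<lparr>carrier := H\<rparr>)" "S = (G\<lparr>carrier := H\<rparr>) Mod K"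
      using \<open>S \<in> group_sections G\<close> by (auto simp: group_sections_def)
    interpret H: group "G\<lparr>carrier := H\<rparr>" using HK(1) by (rule subgroup_imp_group)
    show ?thesis
    proof (cases "H = carrier G")
      case True
      then have K: "K \<lhd> G" using HK(2) by simp
      consider "K = {\<one>}" | "{\<one>, c, d} \<subseteq> K"
      proof -
        have "conj_class G K = {K}"
          using normal_conj_image[OF K] by (auto simp: conj_class_def carrier_eq)
        then have "K \<noteq> {\<one>, r}" if "r \<in> {s, t, u}" for r
        proof -
          have "{\<one>, s} \<noteq> {\<one>, t}" by (simp add: doubleton_eq_iff)
          moreover have "{\<one>, s} \<in> conj_class G {\<one>, r}" "{\<one>, t} \<in> conj_class G {\<one>, r}"
            unfolding conj_class_reflection[OF that] by simp_all
          ultimately show ?thesis using \<open>conj_class G K = {K}\<close> by (metis singletonD)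
        qed
        moreover have "K \<in> {H. subgroup H G}" using normal_imp_subgroup[OF K] by simp
        ultimately have "K \<in> {{\<one>}, {\<one>, c, d}, carrier G}" unfolding subgroups_eq by auto
        then show thesis using that by (auto simp: carrier_eq)
      qed
      then show ?thesis
      proof cases
        case 1
        then show ?thesis using True HK(3) d_prime_Mod_one d_prime_eq_two_thirds by simp
      next
        case 2
        have "x \<otimes> y \<otimes> inv x \<otimes> inv y \<in> {\<one>, c, d}" if "x \<in> carrier G" "y \<in> carrier G" for x y
          using that unfolding carrier_eq by (elim insertE emptyE; simp add: table)
        then have "d_prime (G Mod K) = 1" using 2 by (intro d_prime_Mod_eq_one[OF fin K]) blast
        then show ?thesis using True HK(3) by simp
      qed
    next
      case False
      have finH: "finite (carrier (G\<lparr>carrier := H\<rparr>))" using finite_subgroup[OF fin HK(1)] by simp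
      have "H \<in> {H. subgroup H G}" using HK(1) by simp
      then have "H \<in> {{\<one>}, {\<one>, s}, {\<one>, t}, {\<one>, u}, {\<one>, c, d}}" using False unfolding subgroups_eq by simp
      then have "x \<otimes> y = y \<otimes> x" if "x \<in> H" "y \<in> H" for x y
        using that by (auto simp: table)
      then have "d_prime S = 1"
        unfolding HK(3) using H.commutator_eq_one_iff subgroup.one_closed[OF normal_imp_subgroup[OF HK(2)]]
        by (intro H.d_prime_Mod_eq_one[OF finH HK(2)]) simp
      then show ?thesis by simp
    qed
  qed
  have "G Mod {\<one>} \<in> group_sections G"
    unfolding group_sections_def using subgroup_self one_is_normal by force
  then show ?thesis
    unfolding d_star_def using finite_group_sections[OF fin] ge d_prime_Mod_one d_prime_eq_two_thirds
    by (intro Min_eqI) (auto simp: image_iff intro!: bexI[of _ "G Mod {\<one>}"])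
qed

end

lemma sym_group_3: "symmetric_group_3 (sym_group 3) (transpose 1 2) (transpose 2 3) (transpose 1 3)
  (transpose 1 2 \<circ> transpose 2 3) (transpose 2 3 \<circ> transpose 1 2)"
proof -
  define s t u :: "nat \<Rightarrow> nat" where stu: "s = transpose 1 2" "t = transpose 2 3" "u = transpose 1 3"
  have dist: "distinct [id, s, t, u, s \<circ> t, t \<circ> s]"
    by (auto simp: stu fun_eq_iff transpose_def intro: exI[of _ 1] exI[of _ 2] exI[of _ 3])
  have perm: "{id, s, t, u, s \<circ> t, t \<circ> s} \<subseteq> {p. p permutes {1..3}}"
    by (auto simp: stu intro!: permutes_compose permutes_swap_id permutes_id)
  \<comment> \<open>The six listed permutations are distinct and 3! = 6, so they are all.\<close>
  have "card {id, s, t, u, s \<circ> t, t \<circ> s} = 6" using distinct_card[OF dist] by simp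
  moreover have "card {p. p permutes {1..3::nat}} = 6"
    using card_permutations[of "{1..3::nat}" 3] by (simp add: fact_numeral)
  moreover have "finite {p. p permutes {1..3::nat}}" by (rule finite_permutations) simp
  ultimately have "{p. p permutes {1..3}} = {id, s, t, u, s \<circ> t, t \<circ> s}"
    using perm by (metis card_subset_eq)
  then have carr: "carrier (sym_group 3) = {id, s, t, u, s \<circ> t, t \<circ> s}" by (simp add: sym_group_def)
  show ?thesis
    unfolding symmetric_group_3_def symmetric_group_3_axioms_def stu[symmetric] sym_group_mult sym_group_one
    by (intro conjI; (rule sym_group_is_group | rule carr | rule dist | (simp add: stu fun_eq_iff transpose_def; fail)))
qed

subsection \<open>Modular factors\<close>

lemma (in group) conj_dense_modular_p_group:
  assumes d: "conj_dense G" and K: "subgroup K G" "card K = p ^ k"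
    and p: "Factorial_Ring.prime p" "odd p"
  shows "modular_p_group p (restrict_group G K)"
proof -
  let ?K = "restrict_group G K"
  interpret GK: group "G\<lparr>carrier := K\<rparr>" using K(1) by (rule subgroup_imp_group)
  interpret K: group ?K using K(1) by (rule restrict_group_is_group)
  \<comment> \<open>The identity map passes \<open>conj_dense\<close> from the record that keeps the
    fields of \<open>G\<close> to the plain monoid.\<close>
  interpret h: group_hom "G\<lparr>carrier := K\<rparr>" ?K "\<lambda>x. x"
    by unfold_locales (simp add: hom_def)
  have "conj_dense ?K" using h.conj_dense_image[OF conj_dense_subgroup[OF d K(1)]] by simp
  moreover have ord: "order ?K = p ^ k" using K(2) by (simp add: order_def)
  ultimately have "cyclic_permute ?K" using K.conj_dense_imp_cyclic_permute p by blast
  moreover have fin: "finite (carrier ?K)" using ord p by (metis K.order_gt_0_iff_finite prime_gt_0_nat zero_less_power)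
  ultimately have "modular_lattice (subgroup_lattice ?K)"
    using K.modular_subgroup_lattice K.subgroups_permute by blast
  then show ?thesis unfolding modular_p_group_def using p ord fin K.is_group by blast
qed

lemma (in group) conj_dense_odd_product:
  assumes fin: "finite (carrier G)" and d: "conj_dense G" and odd: "odd (order G)"
  shows "\<exists>(n :: nat) (P :: nat \<Rightarrow> 'a monoid).
    (\<forall>i < n. \<exists>p. modular_p_group p (P i)) \<and> G \<cong> product_group {..<n} P"
proof -
  obtain n P where P: "\<And>i. i < (n::nat) \<Longrightarrow> \<exists>p K. Factorial_Ring.prime p \<and> subgroup K G \<and>
       card K = p ^ multiplicity p (order G) \<and> P i = restrict_group G K"
    and iso: "G \<cong> product_group {..<n} P"
    using iso_product_sylow[OF fin conj_dense_imp_coprime_commute[OF fin d]] by blast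
  have "\<exists>p. modular_p_group p (P i)" if i: "i < n" for i
  proof -
    obtain p K where K: "Factorial_Ring.prime p" "subgroup K G"
      "card K = p ^ multiplicity p (order G)" "P i = restrict_group G K" using P[OF i] by blast
    show ?thesis
    proof (cases "p = 2")
      \<comment> \<open>The product statement does not record that p divides the group order, so p =
        2 may occur formally. Its Sylow subgroup is then trivial and is regarded as a 3-group of
        order 3^0, because the modularity lemma asks for an odd prime.\<close>
      case True
      then have "card K = 3 ^ 0" using K(3) odd by (simp add: not_dvd_imp_multiplicity_0)
      then show ?thesis using conj_dense_modular_p_group[OF d K(2), of 3 0] K(4) by auto
    next
      case False
      then have "odd p" using K(1) prime_odd_nat prime_ge_2_nat[of p] by force
      then show ?thesis using conj_dense_modular_p_group[OF d K(2,3,1)] K(4) by auto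
    qed
  qed
  then show ?thesis using iso by blast
qed

theorem theoremB:
  fixes G :: "('a, 'b) monoid_scheme"
  shows "d_star (sym_group 3) = 2 / 3 \<and> d_prime (sym_group 3) = 2 / 3 \<and>
    (group G \<and> finite (carrier G) \<and> d_star G > 2 / 3 \<longrightarrow>
       nilpotent_group G \<and>
       (\<not> 2 dvd order G \<longrightarrow>
          (\<exists>(n :: nat) (P :: nat \<Rightarrow> 'a monoid).
             (\<forall>i < n. \<exists>p. modular_p_group p (P i)) \<and>
             G \<cong> product_group {..<n} P)))"
proof (intro conjI impI; (elim conjE)?)
  show "d_star (sym_group 3) = 2 / 3" "d_prime (sym_group 3) = 2 / 3"
    using sym_group_3 by (rule symmetric_group_3.d_star_eq_two_thirds symmetric_group_3.d_prime_eq_two_thirds)+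
next
  assume G: "group G" "finite (carrier G)" "2 / 3 < d_star G"
  interpret group G by fact
  have d: "conj_dense G" using d_star_imp_conj_dense G by blast
  show "nilpotent_group G" using conj_dense_imp_nilpotent G(2) d .
  assume "odd (order G)"
  then show "\<exists>(n :: nat) (P :: nat \<Rightarrow> 'a monoid).
      (\<forall>i < n. \<exists>p. modular_p_group p (P i)) \<and> G \<cong> product_group {..<n} P"
    using conj_dense_odd_product G(2) d by blast
qed

end
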